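(* Let $V$ be a finite-dimensional irreducible $U_q(\widehat{\mathfrak{sl}}_2)$-module of type $(1,1)$ such that $P_V\big(q^{-1}(q-q^{-1})^{-2}\big)\neq 0$. Then there exists a unique $\mathcal A_q$-module structure on $V$ such that the standard generators $x$ and $y$ of $\mathcal A_q$ act on $V$ as $e_0^+ + K_0$ and $e_1^+ + K_1$ respectively. This $\mathcal A_q$-module is NonNil, irreducible, and of type $(1,1)$.
   Context: $\mathbb K$ is an algebraically closed field of characteristic $0$, and $q\in\mathbb K$ is nonzero and not a root of unity. For integers $n\ge 0$, $[n]_q=\frac{q^n-q^{-n}}{q-q^{-1}}$, and $[n]_q^!=[n]_q[n-1]_q\cdots[1]_q$ with $[0]_q^!=1$. $\mathcal A_q$ is the unital associative $\mathbb K$-algebra with generators $x,y$ (the standard generators) and relations $x^3y-[3]_qx^2yx+[3]_qxyx^2-yx^3=0$ and $y^3x-[3]_qy^2xy+[3]_qyxy^2-xy^3=0$. A finite-dimensional $\mathcal A_q$-module is NonNil if neither $x$ nor $y$ acts nilpotently on it. For a NonNil finite-dimensional irreducible $\mathcal A_q$-module $V$, it is known that $x,y$ are semisimple on $V$ and that there are an integer $d\ge 0$ and nonzero scalars $\alpha,\alpha^*\in\mathbb K$ such that the set of distinct eigenvalues of $x$ (resp. $y$) on $V$ is $\{\alpha q^{d-2i}\mid 0\le i\le d\}$ (resp. $\{\alpha^* q^{d-2i}\mid 0\le i\le d\}$); the type of $V$ is the ordered pair $(\alpha,\alpha^* )$. $U_q(\widehat{\mathfrak{sl}}_2)$ is the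 unital associative $\mathbb K$-algebra with generators $e_i^{\pm},K_i^{\pm1}$ ($i\in\{0,1\}$) and relations $K_iK_i^{-1}=K_i^{-1}K_i=1$; $K_0K_1=K_1K_0$; $K_ie_i^{\pm}K_i^{-1}=q^{\pm2}e_i^{\pm}$; $K_ie_j^{\pm}K_i^{-1}=q^{\mp2}e_j^{\pm}$ for $i\ne j$; $[e_i^+,e_i^-]=\frac{K_i-K_i^{-1}}{q-q^{-1}}$; $[e_0^{\pm},e_1^{\mp}]=0$; and $(e_i^{\pm})^3e_j^{\pm}-[3]_q(e_i^{\pm})^2e_j^{\pm}e_i^{\pm}+[3]_qe_i^{\pm}e_j^{\pm}(e_i^{\pm})^2-e_j^{\pm}(e_i^{\pm})^3=0$ for $i\neq j$. For a finite-dimensional irreducible $U_q(\widehat{\mathfrak{sl}}_2)$-module $V$ it is known (Chari–Pressley) that there are unique $\varepsilon_0,\varepsilon_1\in\{1,-1\}$ and a unique sequence $U_0,\dots,U_d$ of nonzero subspaces with $V=\bigoplus_{i=0}^dU_i$ such that $K_0$ acts on $U_i$ as $\varepsilon_0q^{2i-d}$ and $K_1$ acts on $U_i$ as $\varepsilon_1q^{d-2i}$; moreover $e_0^+U_i\subseteq U_{i+1}$ and $e_1^+U_i\subseteq U_{i-1}$, where $U_{-1}=U_{d+1}=0$. The type of $V$ is $(\varepsilon_0,\varepsilon_1)$. If $V$ has type $(1,1)$ then $\dim U_0=1$; let $\sigma_i$ ($i\ge0$) be the eigenvalue of $(e_1^+)^i(e_0^+)^i$ on $U_0$ (so $\sigma_i=0$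 for $i>d$). The Drinfel'd polynomial of $V$ is $P_V(z)=\sum_{i=0}^\infty\frac{(-1)^i\sigma_iq^iz^i}{([i]_q^!)^2}\in\mathbb K[z]$. *)

theory Defs
  imports
    "HOL-Library.Poly_Mapping"
    "HOL-Computational_Algebra.Polynomial"
    "HOL-Algebra.QuotRing"
begin

text \<open>
  The free monoid on \<open>'g\<close>. Its operation (concatenation) is written additively, because
  \<^typ>\<open>'a \<Rightarrow>\<^sub>0 'b\<close> is the monoid algebra of an additively written, not necessarily
  commutative, monoid. Hence \<open>'g fmon \<Rightarrow>\<^sub>0 'k\<close> is the free unital associative
  \<open>'k\<close>-algebra on \<open>'g\<close>.
\<close>

datatype 'g fmon = FMon (letters: "'g list")

instantiation fmon :: (type) monoid_add
begin

definition zero_fmon :: "'a fmon" where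
  "0 = FMon []"

definition plus_fmon :: "'a fmon \<Rightarrow> 'a fmon \<Rightarrow> 'a fmon" where
  "u + v = FMon (letters u @ letters v)"

instance
  by standard (auto simp: zero_fmon_def plus_fmon_def)

end

definition free_gen :: "'g \<Rightarrow> ('g fmon \<Rightarrow>\<^sub>0 'k::field)" where
  "free_gen g = Poly_Mapping.single (FMon [g]) 1"

definition free_scalar :: "'k \<Rightarrow> ('g fmon \<Rightarrow>\<^sub>0 'k::field)" where
  "free_scalar c = Poly_Mapping.single 0 c"

definition free_algebra :: "('g fmon \<Rightarrow>\<^sub>0 'k::field) ring" where
  "free_algebra = \<lparr>carrier = UNIV, mult = (*), one = 1, zero = 0, add = (+)\<rparr>"

lemma free_algebra_ring: "ring free_algebra"
proof -
  have "\<exists>y. y + x = 0 \<and> x + y = 0" for x :: "'a fmon \<Rightarrow>\<^sub>0 'b"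
    by (rule exI[of _ "- x"]) simp
  then show ?thesis
    by unfold_locales
      (auto simp: free_algebra_def Units_def add.assoc add.commute mult.assoc
        distrib_left distrib_right)
qed

text \<open>
  A presentation is given by its relators, i.e. a relation \<open>a = b\<close> is given by \<open>a - b\<close>.
  \<^const>\<open>genideal\<close> is the generated two-sided ideal.
\<close>

definition presented_algebra ::
    "('g fmon \<Rightarrow>\<^sub>0 'k::field) set \<Rightarrow> ('g fmon \<Rightarrow>\<^sub>0 'k) set ring" where
  "presented_algebra R = free_algebra Quot (genideal free_algebra R)"

definition presented_class ::
    "('g fmon \<Rightarrow>\<^sub>0 'k::field) set \<Rightarrow> ('g fmon \<Rightarrow>\<^sub>0 'k) \<Rightarrow> ('g fmon \<Rightarrow>\<^sub>0 'k) set" where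
  "presented_class R p = genideal free_algebra R +>\<^bsub>free_algebra\<^esub> p"

text \<open>
  Throughout, the \<open>'k\<close>-vector space \<open>V\<close> is the type \<open>'v\<close> with the scalar
  multiplication \<open>scale\<close>. A module structure on \<open>V\<close> is an action of the algebra which
  induces the given scalar multiplication. As an action is a function with domain the carrier of
  the algebra, it is required to be extensional; otherwise its uniqueness would fail for
  reasons unrelated to the algebra.
\<close>

definition module_structure ::
    "('g fmon \<Rightarrow>\<^sub>0 'k::field) set \<Rightarrow> ('k \<Rightarrow> 'v::ab_group_add \<Rightarrow> 'v) \<Rightarrow>
     (('g fmon \<Rightarrow>\<^sub>0 'k) set \<Rightarrow> 'v \<Rightarrow> 'v) \<Rightarrow> bool" where
  "module_structure R scale act \<longleftrightarrow>
     (let A = presented_algebra R in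
       act \<in> extensional (carrier A) \<and>
       (\<forall>a\<in>carrier A. \<forall>v w. act a (v + w) = act a v + act a w) \<and>
       (\<forall>a\<in>carrier A. \<forall>b\<in>carrier A. \<forall>v. act (a \<oplus>\<^bsub>A\<^esub> b) v = act a v + act b v) \<and>
       (\<forall>a\<in>carrier A. \<forall>b\<in>carrier A. \<forall>v. act (a \<otimes>\<^bsub>A\<^esub> b) v = act a (act b v)) \<and>
       (\<forall>v. act \<one>\<^bsub>A\<^esub> v = v) \<and>
       (\<forall>c v. act (presented_class R (free_scalar c)) v = scale c v))"

definition gen_action ::
    "('g fmon \<Rightarrow>\<^sub>0 'k::field) set \<Rightarrow> (('g fmon \<Rightarrow>\<^sub>0 'k) set \<Rightarrow> 'v \<Rightarrow> 'v) \<Rightarrow>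
     'g \<Rightarrow> 'v \<Rightarrow> 'v" where
  "gen_action R act g = act (presented_class R (free_gen g))"

definition submodule ::
    "('g fmon \<Rightarrow>\<^sub>0 'k::field) set \<Rightarrow> ('k \<Rightarrow> 'v::ab_group_add \<Rightarrow> 'v) \<Rightarrow>
     (('g fmon \<Rightarrow>\<^sub>0 'k) set \<Rightarrow> 'v \<Rightarrow> 'v) \<Rightarrow> 'v set \<Rightarrow> bool" where
  "submodule R scale act W \<longleftrightarrow>
     module.subspace scale W \<and> (\<forall>a\<in>carrier (presented_algebra R). act a ` W \<subseteq> W)"

definition irreducible_module ::
    "('g fmon \<Rightarrow>\<^sub>0 'k::field) set \<Rightarrow> ('k \<Rightarrow> 'v::ab_group_add \<Rightarrow> 'v) \<Rightarrow>
     (('g fmon \<Rightarrow>\<^sub>0 'k) set \<Rightarrow> 'v \<Rightarrow> 'v) \<Rightarrow> bool" where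
  "irreducible_module R scale act \<longleftrightarrow>
     (UNIV :: 'v set) \<noteq> {0} \<and> (\<forall>W. submodule R scale act W \<longrightarrow> W = {0} \<or> W = UNIV)"

definition finite_dimensional :: "('k::field \<Rightarrow> 'v::ab_group_add \<Rightarrow> 'v) \<Rightarrow> bool" where
  "finite_dimensional scale \<longleftrightarrow> (\<exists>B. finite B \<and> module.span scale B = UNIV)"

definition nilpotent_map :: "('v::zero \<Rightarrow> 'v) \<Rightarrow> bool" where
  "nilpotent_map f \<longleftrightarrow> (\<exists>n. \<forall>v. (f ^^ n) v = 0)"

definition eigenvalue_on ::
    "('k \<Rightarrow> 'v::zero \<Rightarrow> 'v) \<Rightarrow> ('v \<Rightarrow> 'v) \<Rightarrow> 'v set \<Rightarrow> 'k \<Rightarrow> bool" where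
  "eigenvalue_on scale f W c \<longleftrightarrow> (\<exists>w\<in>W. w \<noteq> 0 \<and> f w = scale c w)"

definition q_int :: "'k::field \<Rightarrow> nat \<Rightarrow> 'k" where
  "q_int q n = (q ^ n - inverse q ^ n) / (q - inverse q)"

definition q_fact :: "'k::field \<Rightarrow> nat \<Rightarrow> 'k" where
  "q_fact q n = (\<Prod>i = 1..n. q_int q i)"

definition serre_relator ::
    "'k::field \<Rightarrow> ('g fmon \<Rightarrow>\<^sub>0 'k) \<Rightarrow> ('g fmon \<Rightarrow>\<^sub>0 'k) \<Rightarrow> ('g fmon \<Rightarrow>\<^sub>0 'k)" where
  "serre_relator q a b =
     a ^ 3 * b - free_scalar (q_int q 3) * a ^ 2 * b * a
       + free_scalar (q_int q 3) * a * b * a ^ 2 - b * a ^ 3"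

datatype aq_gen = X | Y

definition aq_relators :: "'k::field \<Rightarrow> (aq_gen fmon \<Rightarrow>\<^sub>0 'k) set" where
  "aq_relators q =
     {serre_relator q (free_gen X) (free_gen Y), serre_relator q (free_gen Y) (free_gen X)}"

definition aq_nonnil ::
    "'k::field \<Rightarrow> ((aq_gen fmon \<Rightarrow>\<^sub>0 'k) set \<Rightarrow> 'v::zero \<Rightarrow> 'v) \<Rightarrow> bool" where
  "aq_nonnil q act \<longleftrightarrow>
     \<not> nilpotent_map (gen_action (aq_relators q) act X) \<and>
     \<not> nilpotent_map (gen_action (aq_relators q) act Y)"

definition aq_has_type ::
    "'k::field \<Rightarrow> ('k \<Rightarrow> 'v::ab_group_add \<Rightarrow> 'v) \<Rightarrow>
     ((aq_gen fmon \<Rightarrow>\<^sub>0 'k) set \<Rightarrow> 'v \<Rightarrow> 'v) \<Rightarrow> 'k \<times> 'k \<Rightarrow> bool" where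
  "aq_has_type q scale act = (\<lambda>(\<alpha>, \<alpha>'). \<alpha> \<noteq> 0 \<and> \<alpha>' \<noteq> 0 \<and>
     (\<exists>d::nat.
       {c. eigenvalue_on scale (gen_action (aq_relators q) act X) UNIV c} =
         {\<alpha> * q powi (int d - 2 * int i) | i. i \<le> d} \<and>
       {c. eigenvalue_on scale (gen_action (aq_relators q) act Y) UNIV c} =
         {\<alpha>' * q powi (int d - 2 * int i) | i. i \<le> d}))"

datatype node = N0 | N1

datatype sign = Pos | Neg

text \<open>\<open>E s i\<close>, \<open>K i\<close> and \<open>Kinv i\<close> stand for $e_i^s$, $K_i$ and $K_i^{-1}$.\<close>

datatype uq_gen = E sign node | K node | Kinv node

fun sign_int :: "sign \<Rightarrow> int" where
  "sign_int Pos = 1"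
| "sign_int Neg = - 1"

definition uq_relators :: "'k::field \<Rightarrow> (uq_gen fmon \<Rightarrow>\<^sub>0 'k) set" where
  "uq_relators q =
     (let e = (\<lambda>s i. free_gen (E s i)); k = (\<lambda>i. free_gen (K i)); k' = (\<lambda>i. free_gen (Kinv i)) in
       {k i * k' i - 1 | i. True} \<union>
       {k' i * k i - 1 | i. True} \<union>
       {k N0 * k N1 - k N1 * k N0} \<union>
       {k i * e s i * k' i - free_scalar (q powi (2 * sign_int s)) * e s i | s i. True} \<union>
       {k i * e s j * k' i - free_scalar (q powi (- 2 * sign_int s)) * e s j | s i j. i \<noteq> j} \<union>
       {e Pos i * e Neg i - e Neg i * e Pos i
          - free_scalar (1 / (q - inverse q)) * (k i - k' i) | i. True} \<union>
       {e s N0 * e s' N1 - e s' N1 * e s N0 | s s'. s \<noteq> s'} \<union>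
       {serre_relator q (e s i) (e s j) | s i j. i \<noteq> j})"

text \<open>
  The decomposition \<open>V = U 0 \<oplus> \<dots> \<oplus> U d\<close>. The values \<open>U i\<close> with \<open>i > d\<close>
  are irrelevant.
\<close>

definition uq_decomposition ::
    "'k::field \<Rightarrow> ('k \<Rightarrow> 'v::ab_group_add \<Rightarrow> 'v) \<Rightarrow>
     ((uq_gen fmon \<Rightarrow>\<^sub>0 'k) set \<Rightarrow> 'v \<Rightarrow> 'v) \<Rightarrow> 'k \<Rightarrow> 'k \<Rightarrow> nat \<Rightarrow> (nat \<Rightarrow> 'v set) \<Rightarrow> bool" where
  "uq_decomposition q scale act \<epsilon>\<^sub>0 \<epsilon>\<^sub>1 d U \<longleftrightarrow>
     \<epsilon>\<^sub>0 \<in> {1, - 1} \<and> \<epsilon>\<^sub>1 \<in> {1, - 1} \<and>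
     (\<forall>i\<le>d. module.subspace scale (U i) \<and> U i \<noteq> {0}) \<and>
     (\<forall>v. \<exists>!u. (\<forall>i\<le>d. u i \<in> U i) \<and> (\<forall>i>d. u i = 0) \<and> v = (\<Sum>i\<le>d. u i)) \<and>
     (\<forall>i\<le>d. \<forall>u\<in>U i.
        gen_action (uq_relators q) act (K N0) u = scale (\<epsilon>\<^sub>0 * q powi (2 * int i - int d)) u \<and>
        gen_action (uq_relators q) act (K N1) u = scale (\<epsilon>\<^sub>1 * q powi (int d - 2 * int i)) u)"

definition uq_has_type ::
    "'k::field \<Rightarrow> ('k \<Rightarrow> 'v::ab_group_add \<Rightarrow> 'v) \<Rightarrow>
     ((uq_gen fmon \<Rightarrow>\<^sub>0 'k) set \<Rightarrow> 'v \<Rightarrow> 'v) \<Rightarrow> 'k \<times> 'k \<Rightarrow> bool" where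
  "uq_has_type q scale act =
     (\<lambda>(\<epsilon>\<^sub>0, \<epsilon>\<^sub>1). \<exists>d U. uq_decomposition q scale act \<epsilon>\<^sub>0 \<epsilon>\<^sub>1 d U)"

definition uq_bottom ::
    "'k::field \<Rightarrow> ('k \<Rightarrow> 'v::ab_group_add \<Rightarrow> 'v) \<Rightarrow>
     ((uq_gen fmon \<Rightarrow>\<^sub>0 'k) set \<Rightarrow> 'v \<Rightarrow> 'v) \<Rightarrow> 'v set" where
  "uq_bottom q scale act =
     (THE W. \<exists>\<epsilon>\<^sub>0 \<epsilon>\<^sub>1 d U. uq_decomposition q scale act \<epsilon>\<^sub>0 \<epsilon>\<^sub>1 d U \<and> W = U 0)"

text \<open>
  For irreducible modules of type \<open>(1, 1)\<close> the space \<^const>\<open>uq_bottom\<close> is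
  one-dimensional, so that the eigenvalue is unique, and it is zero for almost all \<open>i\<close>.
\<close>

definition drinfeld_sigma ::
    "'k::field \<Rightarrow> ('k \<Rightarrow> 'v::ab_group_add \<Rightarrow> 'v) \<Rightarrow>
     ((uq_gen fmon \<Rightarrow>\<^sub>0 'k) set \<Rightarrow> 'v \<Rightarrow> 'v) \<Rightarrow> nat \<Rightarrow> 'k" where
  "drinfeld_sigma q scale act i =
     (THE c. eigenvalue_on scale
        ((gen_action (uq_relators q) act (E Pos N1) ^^ i) \<circ>
         (gen_action (uq_relators q) act (E Pos N0) ^^ i))
        (uq_bottom q scale act) c)"

definition drinfeld_poly ::
    "'k::field \<Rightarrow> ('k \<Rightarrow> 'v::ab_group_add \<Rightarrow> 'v) \<Rightarrow>
     ((uq_gen fmon \<Rightarrow>\<^sub>0 'k) set \<Rightarrow> 'v \<Rightarrow> 'v) \<Rightarrow> 'k poly" where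
  "drinfeld_poly q scale act =
     (\<Sum>i | drinfeld_sigma q scale act i \<noteq> 0.
        monom ((- 1) ^ i * drinfeld_sigma q scale act i * q ^ i / (q_fact q i)\<^sup>2) i)"

end

theory Submission
  imports Defs
begin

text \<open>
  Let \<open>V = U\<^sub>0 \<oplus> \<dots> \<oplus> U\<^sub>d\<close> be the weight decomposition of the given module, and write \<open>R\<close>, \<open>L\<close>, \<open>T\<close> for
  the actions of $e_0^+$, $e_1^+$ and $K_0$. Since the type is $(1,1)$, $K_1$ acts as \<open>T\<^sup>-\<^sup>1\<close>, and
  the two operators in question are \<open>x = R + T\<close> and \<open>y = L + T\<^sup>-\<^sup>1\<close>. The cubic relation between
  \<open>R\<close> and \<open>L\<close> says that \<open>L\<close> is annihilated by the product of the three commuting twisted commutators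
  \<open>B \<mapsto> R B - c B R\<close> with \<open>c = q\<^sup>-\<^sup>2, 1, q\<^sup>2\<close>. Passing from \<open>R\<close> to \<open>x\<close> changes these products very
  little, and \<open>T\<^sup>-\<^sup>1\<close> is killed by two of the factors; this gives the relations for \<open>x\<close> and \<open>y\<close>
  (\<open>serre_x_y\<close>) and hence the module structure, which is unique because \<open>x\<close> and \<open>y\<close> generate.
  As \<open>x\<close> and \<open>y\<close> are triangular for the weight decomposition, their eigenvalues are the diagonal
  entries (\<open>x_eigenvalues\<close>), whence the type, and none of them is zero, so the module is NonNil.

  Irreducibility rests on four facts.

  First, \<open>V\<close> is already irreducible under \<open>R\<close>, \<open>L\<close> and \<open>T\<close> (\<open>borel_irreducible\<close>). By \<open>sl\<^sub>2\<close> theory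
  \<open>R\<^sup>k\<close> embeds the weight space of weight \<open>-k\<close> into that of weight \<open>k\<close>, and \<open>L\<^sup>k\<close> goes back. So for a
  stable subspace both maps are bijective, and this makes it stable under $e_0^-$ and $e_1^-$.

  Secondly, each \<open>L\<^sup>i R\<^sup>i\<close> acts on \<open>U\<^sub>0\<close> as a scalar \<open>\<sigma>\<^sub>i\<close> (\<open>bottom_scalar\<close>), so that the Drinfel'd
  polynomial is meaningful. By the cubic relations, \<open>A\<^sup>a B\<^sup>b A\<^sup>c\<close> is a combination of words of the same
  shape in which \<open>a < b\<close> or \<open>c \<le> b\<close> (\<open>exchange\<close>). This implies that the \<open>L\<^sup>i R\<^sup>i\<close> commute on \<open>U\<^sub>0\<close>, and
  that every word of weight zero acts on \<open>U\<^sub>0\<close> as a polynomial in them. So an eigenspace of one of them in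
  \<open>U\<^sub>0\<close> generates a Borel submodule that meets \<open>U\<^sub>0\<close> in nothing else, and is therefore all of \<open>U\<^sub>0\<close>.

  Thirdly, a word in \<open>x\<close> and \<open>y\<close> applied to a weight vector is the same word in \<open>R\<close> and \<open>L\<close> up to
  shorter words. Hence a subspace that is stable under \<open>x\<close> and \<open>y\<close> and contains a nonzero vector of
  \<open>U\<^sub>0\<close> is \<open>V\<close> (\<open>bottom_generates\<close>), and dually every nonzero stable subspace \<open>W\<close> contains a vector
  \<open>w\<close> whose component \<open>u\<close> in \<open>U\<^sub>0\<close> does not vanish (\<open>stable_meets_bottom\<close>).

  Finally, a polynomial in \<open>x\<close> sends \<open>w\<close> to a nonzero multiple of the eigenvector of \<open>x\<close> with \<open>U\<^sub>0\<close>-component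
  \<open>u\<close>, and a polynomial in \<open>y\<close> projects this eigenvector to \<open>U\<^sub>0\<close> along the other eigenspaces of \<open>y\<close>.
  The result is, up to a nonzero factor, the value of the Drinfel'd polynomial at the given point
  times \<open>u\<close> (\<open>coeigen_eigen\<close>, \<open>coeff_product\<close>). If this value is nonzero then \<open>u \<in> W\<close>, and so \<open>W = V\<close>.
\<close>

section \<open>Modules over presented algebras\<close>

text \<open>
  A module over a presented algebra is the same as a representation of the free algebra that kills the
  relators. Working with the free algebra avoids cosets in everything that follows.
\<close>

definition free_rep ::
    "('k::field \<Rightarrow> 'v::ab_group_add \<Rightarrow> 'v) \<Rightarrow> (('g fmon \<Rightarrow>\<^sub>0 'k) \<Rightarrow> 'v \<Rightarrow> 'v) \<Rightarrow> bool" where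
  "free_rep scale \<phi> \<longleftrightarrow>
     (\<forall>p v w. \<phi> p (v + w) = \<phi> p v + \<phi> p w) \<and>
     (\<forall>p r v. \<phi> (p + r) v = \<phi> p v + \<phi> r v) \<and>
     (\<forall>p r v. \<phi> (p * r) v = \<phi> p (\<phi> r v)) \<and>
     (\<forall>c v. \<phi> (free_scalar c) v = scale c v)"

lemma carrier_presented: "carrier (presented_algebra R) = range (presented_class R)"
  by (auto simp: presented_algebra_def presented_class_def FactRing_def A_RCOSETS_def'
      free_algebra_def)

lemma ideal_relators: "ideal (genideal free_algebra R) free_algebra"
  by (rule ring.genideal_ideal[OF free_algebra_ring]) (simp add: free_algebra_def)

lemma relators_in_ideal: "R \<subseteq> genideal free_algebra R"
  by (rule ring.genideal_self[OF free_algebra_ring]) (simp add: free_algebra_def)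

lemma add_presented:
  "presented_class R p \<oplus>\<^bsub>presented_algebra R\<^esub> presented_class R r = presented_class R (p + r)"
  using ideal.a_rcos_sum[OF ideal_relators, of p r R]
  by (simp add: presented_algebra_def presented_class_def FactRing_def free_algebra_def)

lemma mult_presented:
  "presented_class R p \<otimes>\<^bsub>presented_algebra R\<^esub> presented_class R r = presented_class R (p * r)"
  using ideal.rcoset_mult_add[OF ideal_relators, of p r R]
  by (simp add: presented_algebra_def presented_class_def FactRing_def free_algebra_def)

lemma one_presented: "\<one>\<^bsub>presented_algebra R\<^esub> = presented_class R 1"
  by (simp add: presented_algebra_def presented_class_def FactRing_def free_algebra_def)

lemma presented_class_self: "p \<in> presented_class R p"
  unfolding presented_class_def
  by (rule abelian_subgroup.a_rcos_self)
    (use ideal_relators[of R] in \<open>auto simp: free_algebra_def ideal_def intro: abelian_subgroupI3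
      additive_subgroup.intro ring.is_abelian_group[OF free_algebra_ring, unfolded free_algebra_def]\<close>)

lemma presented_class_diff:
  assumes "r \<in> presented_class R p"
  shows "r - p \<in> genideal free_algebra R"
proof -
  obtain h where "h \<in> genideal free_algebra R" "r = h + p"
    using assms by (auto simp: presented_class_def a_r_coset_def r_coset_def free_algebra_def)
  then show ?thesis by simp
qed

text \<open>
  A relator lies in the ideal by which one divides, so its coset is the coset of zero.
\<close>

lemma presented_class_relator:
  assumes "r \<in> R"
  shows "presented_class R r = presented_class R 0"
proof -
  have "r \<in> genideal free_algebra R"
    using assms relators_in_ideal by blast
  then have "genideal free_algebra R +>\<^bsub>free_algebra\<^esub> r = genideal free_algebra R"
    by (intro abelian_subgroup.a_rcos_const)
      (use ideal_relators[of R] in \<open>auto simp: ideal_def intro: abelian_subgroupI3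
        ring.is_abelian_group[OF free_algebra_ring]\<close>)
  moreover have "genideal free_algebra R +>\<^bsub>free_algebra\<^esub> 0 = genideal free_algebra R"
    by (auto simp: a_r_coset_def r_coset_def free_algebra_def)
  ultimately show ?thesis
    by (simp add: presented_class_def)
qed

lemma update_eq_single_plus:
  fixes p :: "'a \<Rightarrow>\<^sub>0 'b::comm_monoid_add"
  assumes "a \<notin> Poly_Mapping.keys p"
  shows "Poly_Mapping.update a b p = Poly_Mapping.single a b + p"
  using assms by (intro poly_mapping_eqI)
    (auto simp: update.rep_eq lookup_add lookup_single when_def in_keys_iff)

lemma one_free: "(1 :: 'g fmon \<Rightarrow>\<^sub>0 'k::field) = free_scalar 1"
  by (simp add: free_scalar_def)

context
  fixes scale :: "'k::field \<Rightarrow> 'v::ab_group_add \<Rightarrow> 'v"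
  assumes vs: "vector_space scale"
begin

interpretation vector_space scale by (fact vs)

lemma free_rep_zero:
  assumes "free_rep scale \<phi>"
  shows "\<phi> 0 v = 0"
  using assms unfolding free_rep_def by (metis add_cancel_right_right)

lemma free_rep_minus:
  assumes "free_rep scale \<phi>"
  shows "\<phi> (p - r) v = \<phi> p v - \<phi> r v"
proof -
  have "\<phi> (p - r + r) v = \<phi> (p - r) v + \<phi> r v"
    using assms unfolding free_rep_def by blast
  then show ?thesis by simp
qed

lemma free_rep_one:
  assumes "free_rep scale \<phi>"
  shows "\<phi> 1 v = v"
  using assms unfolding free_rep_def one_free by simp

text \<open>
  The scalars are central in the free algebra.
\<close>

lemma free_rep_commutes_scale:
  assumes "free_rep scale \<phi>"
  shows "\<phi> p (scale c v) = scale c (\<phi> p v)"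
proof -
  have "p * free_scalar c = free_scalar c * p"
  proof (induction p rule: update_induct)
    case (update f a b)
    then show ?case
      by (simp add: update_eq_single_plus algebra_simps free_scalar_def mult_single)
  qed simp
  then show ?thesis
    using assms unfolding free_rep_def by metis
qed

lemma free_rep_linear:
  assumes "free_rep scale \<phi>"
  shows "Vector_Spaces.linear scale scale (\<phi> p)"
  using assms free_rep_commutes_scale[OF assms]
  by (simp add: Vector_Spaces.linear_iff free_rep_def vs)

lemma free_algebra_induct [case_names scalar gen add mult]:
  fixes p :: "'g fmon \<Rightarrow>\<^sub>0 'k"
  assumes "\<And>c. P (free_scalar c)" and "\<And>g. P (free_gen g)"
    and "\<And>p r. P p \<Longrightarrow> P r \<Longrightarrow> P (p + r)" and "\<And>p r. P p \<Longrightarrow> P r \<Longrightarrow> P (p * r)"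
  shows "P p"
proof (induction p rule: update_induct)
  case const
  then show ?case
    using assms(1)[of 0] by (simp add: free_scalar_def)
next
  case (update f a b)
  have word: "P (Poly_Mapping.single (FMon ls) 1)" for ls
  proof (induction ls)
    case Nil
    then show ?case
      using assms(1)[of 1] by (simp add: free_scalar_def zero_fmon_def)
  next
    case (Cons l ls)
    have "Poly_Mapping.single (FMon (l # ls)) (1::'k) = free_gen l * Poly_Mapping.single (FMon ls) 1"
      by (simp add: free_gen_def mult_single plus_fmon_def)
    then show ?case
      using assms Cons by metis
  qed
  have "Poly_Mapping.single a b = free_scalar b * Poly_Mapping.single (FMon (letters a)) 1"
    by (simp add: free_scalar_def mult_single)
  then have "P (Poly_Mapping.single a b)"
    using assms word by metis
  then show ?case
    using assms(3) update by (simp add: update_eq_single_plus)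
qed

lemma free_rep_unique:
  assumes "free_rep scale \<phi>" "free_rep scale \<psi>"
    and "\<And>g. \<phi> (free_gen g) = \<psi> (free_gen g)"
  shows "\<phi> p = \<psi> p"
  by (induction p rule: free_algebra_induct) (use assms in \<open>auto simp: free_rep_def fun_eq_iff\<close>)

lemma free_rep_stable:
  assumes "free_rep scale \<phi>" "subspace W"
    and "\<And>g. \<phi> (free_gen g) ` W \<subseteq> W"
  shows "\<phi> p ` W \<subseteq> W"
proof (induction p rule: free_algebra_induct)
  case (scalar c)
  then show ?case
    using assms by (auto simp: free_rep_def intro: subspace_scale)
next
  case (add p r)
  then show ?case
    using assms by (auto simp: free_rep_def intro!: subspace_add)
qed (use assms in \<open>auto simp: free_rep_def\<close>)

lemma module_structure_free_rep:
  assumes "module_structure R scale act"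
  shows "free_rep scale (\<lambda>p. act (presented_class R p))"
  using assms
  unfolding module_structure_def Let_def carrier_presented free_rep_def
  by (simp add: add_presented mult_presented)

lemma module_structure_relator:
  assumes "module_structure R scale act" "r \<in> R"
  shows "act (presented_class R r) v = 0"
  using free_rep_zero[OF module_structure_free_rep[OF assms(1)]] presented_class_relator[OF assms(2)]
  by simp

lemma module_structure_unique:
  assumes "module_structure R scale act" "module_structure R scale act'"
    and "\<And>g. gen_action R act g = gen_action R act' g"
  shows "act = act'"
proof (rule extensionalityI)
  show "act \<in> extensional (carrier (presented_algebra R))"
    "act' \<in> extensional (carrier (presented_algebra R))"
    using assms by (simp_all add: module_structure_def Let_def)
  show "act a = act' a" if "a \<in> carrier (presented_algebra R)" for a
    using that free_rep_unique[OF module_structure_free_rep[OF assms(1)]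
        module_structure_free_rep[OF assms(2)]] assms(3)
    by (auto simp: carrier_presented gen_action_def)
qed

lemma stable_imp_submodule:
  assumes "module_structure R scale act" "subspace W"
    and "\<And>g. gen_action R act g ` W \<subseteq> W"
  shows "submodule R scale act W"
  using assms free_rep_stable[OF module_structure_free_rep[OF assms(1)]]
  by (auto simp: submodule_def carrier_presented gen_action_def)

lemma submodule_stable:
  assumes "submodule R scale act W" "w \<in> W"
  shows "gen_action R act g w \<in> W"
  using assms by (auto simp: submodule_def carrier_presented gen_action_def)

text \<open>
  The elements that act as zero form a two-sided ideal. If it contains the relators, it contains the
  ideal that they generate, so the action is well defined on cosets.
\<close>

lemma free_rep_factors:
  assumes rep: "free_rep scale \<phi>" and rel: "\<And>r v. r \<in> R \<Longrightarrow> \<phi> r v = 0"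
  shows "\<exists>act. module_structure R scale act \<and> (\<forall>g. gen_action R act g = \<phi> (free_gen g))"
proof -
  define I where "I = {p. \<forall>v. \<phi> p v = 0}"
  have \<phi>_0: "\<phi> p 0 = 0" for p
    using rep unfolding free_rep_def by (metis add_cancel_right_right)
  have uminus: "\<phi> (- p) v = - \<phi> p v" for p v
    using free_rep_minus[OF rep, of 0 p v] free_rep_zero[OF rep] by simp
  have inv_free: "\<ominus>\<^bsub>free_algebra\<^esub> p = - p" for p :: "'a fmon \<Rightarrow>\<^sub>0 'k"
    using ring.ring_simprules(9,17)[OF free_algebra_ring, of p]
    by (simp add: free_algebra_def eq_neg_iff_add_eq_0 add.commute)
  have "ideal I free_algebra"
  proof (rule idealI[OF free_algebra_ring])
    show "subgroup I (add_monoid free_algebra)"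
      by (rule subgroup.intro)
        (use rep uminus inv_free in \<open>auto simp: I_def free_rep_def free_rep_zero[OF rep] free_algebra_def a_inv_def\<close>)
  qed (use rep \<phi>_0 in \<open>auto simp: I_def free_rep_def free_algebra_def\<close>)
  moreover have "R \<subseteq> I"
    using rel by (auto simp: I_def)
  ultimately have idl: "genideal free_algebra R \<subseteq> I"
    by (rule ring.genideal_minimal[OF free_algebra_ring])
  \<comment> \<open>The restriction makes the action extensional, as a module structure has to be.\<close>
  define act where
    "act = restrict (\<lambda>C. \<phi> (SOME p. p \<in> C)) (carrier (presented_algebra R))"
  have act: "act (presented_class R p) = \<phi> p" for p
  proof -
    have "(SOME r. r \<in> presented_class R p) \<in> presented_class R p"
      using presented_class_self by (rule someI)
    then have "(SOME r. r \<in> presented_class R p) - p \<in> I"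
      using presented_class_diff idl by blast
    then have "\<phi> (SOME r. r \<in> presented_class R p) v = \<phi> p v" for v
      by (simp add: I_def free_rep_minus[OF rep])
    then show ?thesis
      by (auto simp: act_def carrier_presented)
  qed
  have "module_structure R scale act"
    unfolding module_structure_def Let_def carrier_presented
    using rep act
    by (auto simp: free_rep_def add_presented mult_presented one_presented free_rep_one[OF rep])
      (simp add: act_def carrier_presented)
  then show ?thesis
    using act by (auto simp: gen_action_def)
qed

text \<open>
  The universal property of the free algebra: a word acts by composing the maps of its letters.
\<close>

lemma free_rep_exists:
  fixes f :: "'g \<Rightarrow> 'v \<Rightarrow> 'v"
  assumes lin: "\<And>g. Vector_Spaces.linear scale scale (f g)"
  shows "\<exists>\<phi>. free_rep scale \<phi> \<and> (\<forall>g. \<phi> (free_gen g) = f g)"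
proof -
  define word where "word w = foldr f (letters w)" for w :: "'g fmon"
  define \<phi> where "\<phi> p v = (\<Sum>w\<in>Poly_Mapping.keys p. scale (Poly_Mapping.lookup p w) (word w v))"
    for p :: "'g fmon \<Rightarrow>\<^sub>0 'k" and v
  have lin_word: "Vector_Spaces.linear scale scale (word w)" for w
  proof -
    have "Vector_Spaces.linear scale scale (foldr f ls)" for ls
      using lin by (induction ls) (simp_all add: Vector_Spaces.linear_iff vs)
    then show ?thesis by (simp add: word_def)
  qed
  have word_plus: "word (a + b) v = word a (word b v)" for a b v
    by (simp add: word_def plus_fmon_def)
  have add: "\<phi> (p + r) v = \<phi> p v + \<phi> r v" for p r v
    unfolding \<phi>_def by (rule setsum_keys_plus_distrib[where f = "\<lambda>w c. scale c (word w v)"]) (auto simp: scale_left_distrib)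
  have single: "\<phi> (Poly_Mapping.single a c) v = scale c (word a v)" for a c v
    by (simp add: \<phi>_def)
  have vadd: "\<phi> p (v + w) = \<phi> p v + \<phi> p w" for p v w
    using lin_word by (simp add: \<phi>_def Vector_Spaces.linear_iff scale_right_distrib sum.distrib)
  have zero: "\<phi> 0 v = 0" for v
    by (simp add: \<phi>_def)
  have vscale: "\<phi> p (scale c v) = scale c (\<phi> p v)" for p c v
    using lin_word by (simp add: \<phi>_def Vector_Spaces.linear_iff scale_sum_right mult.commute)
  have mult_single_left: "\<phi> (Poly_Mapping.single a c * r) v = scale c (word a (\<phi> r v))" for a c r v
  proof (induction r rule: update_induct)
    case const
    then show ?case
      using lin_word[of a] by (simp add: zero Vector_Spaces.linear_iff) (metis scale_zero_left scale_zero_right)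
  next
    case (update r a' b)
    then show ?case
      using lin_word by (simp add: update_eq_single_plus distrib_left add mult_single single word_plus Vector_Spaces.linear_iff scale_right_distrib)
  qed
  have mult: "\<phi> (p * r) v = \<phi> p (\<phi> r v)" for p r v
    by (induction p rule: update_induct) (simp_all add: zero update_eq_single_plus distrib_right add mult_single_left single)
  have "free_rep scale \<phi>"
    using vadd add mult by (auto simp: free_rep_def free_scalar_def single word_def zero_fmon_def)
  moreover have "\<phi> (free_gen g) = f g" for g
    by (simp add: fun_eq_iff free_gen_def single word_def)
  ultimately show ?thesis by blast
qed

end

section \<open>Twisted commutators and the cubic Serre relation\<close>

locale q_vector_space = vector_space scale
  for scale :: "'k::field \<Rightarrow> 'v::ab_group_add \<Rightarrow> 'v" (infixr \<open>*s\<close> 75) +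
  fixes q :: 'k
  assumes q_nonzero: "q \<noteq> 0"
    and q_not_root: "n > 0 \<Longrightarrow> q ^ n \<noteq> 1"
begin

abbreviation endo :: "('v \<Rightarrow> 'v) \<Rightarrow> bool" where
  "endo f \<equiv> Vector_Spaces.linear scale scale f"

lemma endo_iff: "endo f \<longleftrightarrow> (\<forall>v w. f (v + w) = f v + f w) \<and> (\<forall>c v. f (c *s v) = c *s f v)"
  by (simp add: Vector_Spaces.linear_iff vector_space_axioms)

lemma endo_add: "endo f \<Longrightarrow> f (v + w) = f v + f w"
  and endo_scale: "endo f \<Longrightarrow> f (c *s v) = c *s f v"
  by (simp_all add: endo_iff)

lemma endo_zero: "endo f \<Longrightarrow> f 0 = 0"
  using endo_scale[of f 0 0] by simp

lemma endo_diff: "endo f \<Longrightarrow> f (v - w) = f v - f w"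
  using endo_add[of f "v - w" w] by simp

lemma endo_sum: "endo f \<Longrightarrow> f (sum g A) = (\<Sum>a\<in>A. f (g a))"
  by (induction A rule: infinite_finite_induct) (simp_all add: endo_zero endo_add)

lemma endo_comp: "endo f \<Longrightarrow> endo g \<Longrightarrow> endo (\<lambda>v. f (g v))"
  by (simp add: endo_iff)

lemma endo_funpow: "endo f \<Longrightarrow> endo (f ^^ n)"
  by (induction n) (simp_all add: endo_iff)

lemmas endo_simps = endo_add endo_scale endo_zero endo_diff endo_sum

lemma span_stable:
  assumes "endo f" "\<And>g. g \<in> G \<Longrightarrow> f g \<in> span G"
  shows "f ` span G \<subseteq> span G"
proof clarify
  fix w assume "w \<in> span G"
  then show "f w \<in> span G"
    by (induction rule: span_induct_alt)
      (use assms in \<open>simp_all add: endo_simps span_zero span_add span_scale\<close>)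
qed

text \<open>
  That \<open>q\<close> is not a root of unity enters through this: the weights, the nodes of the interpolation and
  the eigenvalues of \<open>x\<close> and \<open>y\<close> are distinct.
\<close>

lemma q_powi_inj:
  assumes "q powi m = q powi n"
  shows "m = n"
proof -
  have *: "q powi k \<noteq> 1" if "k > 0" for k
    using q_not_root[of "nat k"] that by (simp add: power_int_def)
  have "q powi (m - n) = 1" "q powi (n - m) = 1"
    using assms q_nonzero by (simp_all add: power_int_diff)
  then show ?thesis
    using *[of "m - n"] *[of "n - m"] by (metis diff_gt_0_iff_gt linorder_neqE)
qed

lemma q_powi_eq_iff: "q powi m = q powi n \<longleftrightarrow> m = n"
  using q_powi_inj by blast

text \<open>
  For fixed \<open>A\<close> the operators \<open>B \<mapsto> A B - c B A\<close> commute with each other. If left and right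
  multiplication by \<open>A\<close> are regarded as commuting variables \<open>\<lambda>\<close> and \<open>\<rho>\<close>, this is multiplication
  by \<open>\<lambda> - c \<rho>\<close>.
\<close>

definition twist :: "('v \<Rightarrow> 'v) \<Rightarrow> 'k \<Rightarrow> ('v \<Rightarrow> 'v) \<Rightarrow> 'v \<Rightarrow> 'v" where
  "twist A c T v = A (T v) - c *s T (A v)"

text \<open>
  The product of \<open>\<lambda> - q\<^sup>2\<^sup>j \<rho>\<close> over the \<open>n\<close> integers \<open>j\<close> from \<open>s\<close> upwards annihilates the map.
  The factor with the largest \<open>j\<close> is applied first because the product rule below splits off that
  one. For \<open>s = - 1\<close> and \<open>n = 3\<close> the product is \<open>\<lambda>\<^sup>3 - [3] \<lambda>\<^sup>2 \<rho> + [3] \<lambda> \<rho>\<^sup>2 - \<rho>\<^sup>3\<close>, which is the cubic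
  Serre relation.
\<close>

fun killed :: "('v \<Rightarrow> 'v) \<Rightarrow> int \<Rightarrow> nat \<Rightarrow> ('v \<Rightarrow> 'v) \<Rightarrow> bool" where
  "killed A s 0 T \<longleftrightarrow> (\<forall>v. T v = 0)"
| "killed A s (Suc n) T \<longleftrightarrow> killed A s n (twist A (q powi (2 * (s + int n))) T)"

abbreviation serre :: "('v \<Rightarrow> 'v) \<Rightarrow> ('v \<Rightarrow> 'v) \<Rightarrow> bool" where
  "serre A T \<equiv> killed A (- 1) 3 T"

lemma endo_twist: "endo A \<Longrightarrow> endo T \<Longrightarrow> endo (twist A c T)"
  by (simp add: endo_iff twist_def algebra_simps)

lemma killed_lincomb:
  assumes "endo A" "killed A s n S" "killed A s n T"
  shows "killed A s n (\<lambda>v. S v + c *s T v)"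
  using assms(2,3)
proof (induction n arbitrary: S T)
  case (Suc n)
  have "twist A e (\<lambda>v. S v + c *s T v) = (\<lambda>v. twist A e S v + c *s twist A e T v)" for e
    using assms(1) by (simp add: fun_eq_iff twist_def endo_simps algebra_simps)
  then show ?case
    using Suc by simp
qed simp

lemma killed_zero: "endo A \<Longrightarrow> \<forall>v. T v = 0 \<Longrightarrow> killed A s n T"
  by (induction n arbitrary: T) (simp_all add: twist_def endo_zero)

text \<open>
  With a third variable \<open>\<mu>\<close> for inserting \<open>A\<close> between the two factors this is the identity
  \<open>\<lambda> - c e \<rho> = (\<lambda> - c \<mu>) + c (\<mu> - e \<rho>)\<close>.
\<close>

lemma twist_product:
  assumes "endo S"
  shows "twist A (c * e) (\<lambda>v. S (T v)) = (\<lambda>v. twist A c S (T v) + c *s S (twist A e T v))"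
  using assms by (simp add: fun_eq_iff twist_def endo_simps algebra_simps)

text \<open>
  The largest exponents of the two strings add up to the largest exponent of the claimed one, so by the
  product rule the first twisted commutator leaves two products in which one string or the other has
  become shorter.
\<close>

lemma killed_product:
  assumes "endo A" "endo S" "endo T" "killed A s m S" "killed A t n T"
  shows "killed A (s + t) (m + n - 1) (\<lambda>v. S (T v))"
  using assms(2-)
proof (induction "m + n" arbitrary: m n S T rule: less_induct)
  case less
  show ?case
  proof (cases m)
    case 0
    then show ?thesis
      using less by (intro killed_zero[OF assms(1)]) auto
  next
    case m: (Suc m')
    show ?thesis
    proof (cases n)
      case 0
      then show ?thesis
        using less by (intro killed_zero[OF assms(1)]) (auto simp: endo_zero)
    next
      case n: (Suc n')
      let ?c = "q powi (2 * (s + int m'))" and ?e = "q powi (2 * (t + int n'))"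
      have "killed A (s + t) (m' + n - 1) (\<lambda>v. twist A ?c S (T v))"
        by (rule less(1)) (use less(2-) m n assms(1) in \<open>auto intro: endo_twist\<close>)
      moreover have "killed A (s + t) (m + n' - 1) (\<lambda>v. S (twist A ?e T v))"
        by (rule less(1)) (use less(2-) m n assms(1) in \<open>auto intro: endo_twist\<close>)
      ultimately have "killed A (s + t) (m' + n') (\<lambda>v. twist A ?c S (T v) + ?c *s S (twist A ?e T v))"
        using m n assms(1) by (intro killed_lincomb) simp_all
      moreover have "q powi (2 * (s + t + int (m' + n'))) = ?c * ?e"
        using q_nonzero by (simp add: algebra_simps flip: power_int_add)
      ultimately show ?thesis
        using m n twist_product[OF less(2), of A ?c ?e T] by simp
    qed
  qed
qed

lemma serre_power:
  assumes "endo A" "endo B" "serre A B"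
  shows "killed A (- int b) (2 * b + 1) (B ^^ b)"
proof (induction b)
  case 0
  show ?case by (simp add: twist_def id_def)
next
  case (Suc b)
  have "killed A (- 1 + - int b) (3 + (2 * b + 1) - 1) (\<lambda>v. B ((B ^^ b) v))"
    by (rule killed_product[OF assms(1,2) endo_funpow[OF assms(2)] assms(3) Suc.IH])
  moreover have "(B ^^ Suc b) = (\<lambda>v. B ((B ^^ b) v))"
    by (simp add: fun_eq_iff)
  moreover have "- 1 + - int b = - int (Suc b)" "3 + (2 * b + 1) - 1 = 2 * Suc b + 1"
    by simp_all
  ultimately show ?case by metis
qed

text \<open>
  The homogeneous polynomial of degree \<open>m\<close> in left and right multiplication by \<open>A\<close> whose
  dehomogenisation is \<open>p\<close>, applied to the map.
\<close>

definition sandwich :: "('v \<Rightarrow> 'v) \<Rightarrow> nat \<Rightarrow> 'k poly \<Rightarrow> ('v \<Rightarrow> 'v) \<Rightarrow> 'v \<Rightarrow> 'v" where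
  "sandwich A m p T v = (\<Sum>i\<le>m. coeff p i *s (A ^^ i) (T ((A ^^ (m - i)) v)))"

lemma sandwich_twist:
  assumes "endo A" "degree p \<le> m"
  shows "sandwich A (Suc m) ([:- c, 1:] * p) T v = sandwich A m p (twist A c T) v"
proof -
  let ?t = "\<lambda>i. (A ^^ i) (T ((A ^^ (Suc m - i)) v))"
  have top: "coeff p (Suc m) = 0"
    using assms(2) by (intro coeff_eq_0) simp
  have "sandwich A (Suc m) ([:- c, 1:] * p) T v =
      (\<Sum>i\<le>Suc m. coeff (pCons 0 p) i *s ?t i) - (\<Sum>i\<le>Suc m. (c * coeff p i) *s ?t i)"
    by (simp only: sandwich_def flip: sum_subtractf scale_left_diff_distrib) simp
  also have "(\<Sum>i\<le>Suc m. coeff (pCons 0 p) i *s ?t i) = (\<Sum>i\<le>m. coeff p i *s ?t (Suc i))"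
    by (subst sum.atMost_Suc_shift) simp
  also have "(\<Sum>i\<le>Suc m. (c * coeff p i) *s ?t i) = (\<Sum>i\<le>m. (c * coeff p i) *s ?t i)"
    using top by simp
  also have "(\<Sum>i\<le>m. coeff p i *s ?t (Suc i)) - (\<Sum>i\<le>m. (c * coeff p i) *s ?t i) =
      (\<Sum>i\<le>m. coeff p i *s (?t (Suc i) - c *s ?t i))"
    by (simp add: sum_subtractf scale_right_diff_distrib mult.commute)
  also have "\<dots> = sandwich A m p (twist A c T) v"
    unfolding sandwich_def
  proof (rule sum.cong)
    fix i assume "i \<in> {..m}"
    then have "Suc m - i = Suc (m - i)" by simp
    then show "coeff p i *s (?t (Suc i) - c *s ?t i) =
        coeff p i *s (A ^^ i) (twist A c T ((A ^^ (m - i)) v))"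
      using endo_funpow[OF assms(1), of i]
      by (simp add: twist_def endo_simps funpow_swap1)
  qed simp
  finally show ?thesis .
qed

lemma sandwich_diff: "sandwich A m (p - r) T v = sandwich A m p T v - sandwich A m r T v"
  by (simp add: sandwich_def algebra_simps sum_subtractf)

lemma sandwich_sum: "sandwich A m (\<Sum>a\<in>S. f a) T v = (\<Sum>a\<in>S. sandwich A m (f a) T v)"
  by (simp add: sandwich_def coeff_sum scale_sum_left) (rule sum.swap)

lemma sandwich_monom:
  assumes "i \<le> m"
  shows "sandwich A m (monom c i) T v = c *s (A ^^ i) (T ((A ^^ (m - i)) v))"
proof -
  have "sandwich A m (monom c i) T v =
      (\<Sum>j\<le>m. if j = i then c *s (A ^^ i) (T ((A ^^ (m - i)) v)) else 0)"
    unfolding sandwich_def by (rule sum.cong) auto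
  then show ?thesis
    using assms by simp
qed

text \<open>
  A polynomial that vanishes at all points of the string is divisible by the product of the linear
  factors, and that product annihilates the map.
\<close>

lemma killed_imp_sandwich_zero:
  assumes "endo A" "killed A s n T" "degree p \<le> m"
    and "\<And>j. s \<le> j \<Longrightarrow> j < s + int n \<Longrightarrow> poly p (q powi (2 * j)) = 0"
  shows "sandwich A m p T v = 0"
  using assms(2-)
proof (induction n arbitrary: T p m)
  case 0
  then show ?case
    using endo_zero[OF endo_funpow[OF assms(1)]] by (simp add: sandwich_def)
next
  case (Suc n)
  let ?c = "q powi (2 * (s + int n))"
  have "poly p ?c = 0"
    using Suc.prems(3)[of "s + int n"] by simp
  then obtain r where r: "p = [:- ?c, 1:] * r"
    by (auto simp: poly_eq_0_iff_dvd elim: dvdE)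
  show ?case
  proof (cases "p = 0")
    case True
    then show ?thesis by (simp add: sandwich_def)
  next
    case False
    then have "r \<noteq> 0"
      using r by auto
    then have deg: "degree p = Suc (degree r)"
      unfolding r by (subst degree_mult_eq) auto
    then obtain m' where m': "m = Suc m'" "degree r \<le> m'"
      using Suc.prems(2) by (cases m) auto
    have "poly r (q powi (2 * j)) = 0" if "s \<le> j" "j < s + int n" for j
    proof -
      have "poly p (q powi (2 * j)) = 0"
        using that Suc.prems(3) by simp
      moreover have "q powi (2 * j) \<noteq> ?c"
        using that by (simp add: q_powi_eq_iff)
      ultimately show ?thesis
        unfolding r by simp
    qed
    then have "sandwich A m' r (twist A ?c T) v = 0"
      using Suc.IH[of "twist A ?c T" r m'] Suc.prems(1) m'(2) by simp
    then show ?thesis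
      unfolding r m'(1) using sandwich_twist[OF assms(1) m'(2)] by simp
  qed
qed

end

text \<open>
  Lagrange interpolation is exact on polynomials of degree less than the number of nodes; the weights
  are the values at \<open>x\<close> of the basis polynomials.
\<close>

lemma lagrange_weights:
  fixes node :: "'a \<Rightarrow> 'k::field"
  assumes "finite D" "inj_on node D"
  shows "\<exists>k. \<forall>j<card D. x ^ j = (\<Sum>e\<in>D. k e * node e ^ j)"
proof -
  define l where "l e = (\<Prod>f\<in>D - {e}. smult (inverse (node e - node f)) [:- node f, 1:])" for e
  have l: "poly (l e) (node f) = (if f = e then 1 else 0)" if "e \<in> D" "f \<in> D" for e f
  proof (cases "f = e")
    case True
    have "poly (smult (inverse (node e - node g)) [:- node g, 1:]) (node e) = 1"
      if "g \<in> D - {e}" for g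
    proof -
      have "node e - node g \<noteq> 0"
        using that \<open>e \<in> D\<close> assms(2) by (auto simp: inj_on_def)
      then have "inverse (node e - node g) * (node e - node g) = 1"
        by simp
      then show ?thesis by (simp add: algebra_simps)
    qed
    then show ?thesis
      using True unfolding l_def poly_prod by simp
  next
    case False
    then have "f \<in> D - {e}" using that by simp
    then have "poly (l e) (node f) = 0"
      using assms(1) unfolding l_def poly_prod by (intro prod_zero) auto
    then show ?thesis using False by simp
  qed
  have deg_l: "degree (l e) < card D" if "e \<in> D" for e
  proof -
    have "degree (l e) \<le> (\<Sum>f\<in>D - {e}. degree (smult (inverse (node e - node f)) [:- node f, 1:]))"
      using degree_prod_sum_le[of "D - {e}" "\<lambda>f. smult (inverse (node e - node f)) [:- node f, 1:]"] assms(1)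
      by (simp add: l_def o_def)
    also have "\<dots> \<le> (\<Sum>f\<in>D - {e}. 1)"
      by (intro sum_mono) simp
    also have "\<dots> < card D"
      using that assms(1) card_gt_0_iff[of D] by auto
    finally show ?thesis .
  qed
  show ?thesis
  proof (intro exI allI impI)
    fix j assume j: "j < card D"
    let ?P = "(\<Sum>e\<in>D. smult (node e ^ j) (l e)) - monom 1 j"
    have roots: "node ` D \<subseteq> {y. poly ?P y = 0}"
    proof (clarsimp simp: poly_sum poly_monom)
      fix f assume f: "f \<in> D"
      have "(\<Sum>e\<in>D. node e ^ j * poly (l e) (node f)) = (\<Sum>e\<in>D. if e = f then node f ^ j else 0)"
        by (rule sum.cong) (auto simp: l f)
      then show "(\<Sum>e\<in>D. node e ^ j * poly (l e) (node f)) = node f ^ j"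
        using f assms(1) by simp
    qed
    have "degree ?P < card D"
    proof (rule degree_diff_less)
      show "degree (\<Sum>e\<in>D. smult (node e ^ j) (l e)) < card D"
        using deg_l j assms(1) by (intro degree_sum_less) (auto intro: le_less_trans[OF degree_smult_le])
      show "degree (monom (1::'k) j) < card D"
        using j by (intro le_less_trans[OF degree_monom_le])
    qed
    moreover have "card D \<le> degree ?P" if "?P \<noteq> 0"
    proof -
      have "card D = card (node ` D)"
        by (rule card_image[symmetric, OF assms(2)])
      also have "\<dots> \<le> card {y. poly ?P y = 0}"
        by (rule card_mono[OF poly_roots_finite[OF that] roots])
      also have "\<dots> \<le> degree ?P"
        by (rule card_poly_roots_bound[OF that])
      finally show ?thesis .
    qed
    ultimately have "?P = 0"
      by (meson leD)
    then have "poly ?P x = 0" by simp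
    then show "x ^ j = (\<Sum>e\<in>D. poly (l e) x * node e ^ j)"
      by (simp add: poly_sum poly_monom mult.commute)
  qed
qed

context q_vector_space
begin

text \<open>
  The exponent \<open>a\<close> and the elements of \<open>D\<close> are regarded as the nodes \<open>q\<^sup>2\<^sup>e\<close>, so that \<open>j\<close> becomes the degree.
  The interpolation formula covers the degrees \<open>0, \<dots>, 2b\<close>; rescaling the weights shifts this range to
  \<open>-b, \<dots>, b\<close>.
\<close>

lemma q_interpolation:
  assumes "finite D" "card D = 2 * b + 1"
  shows "\<exists>k. \<forall>j. - int b \<le> j \<longrightarrow> j \<le> int b \<longrightarrow>
    q powi (2 * j * a) = (\<Sum>e\<in>D. k e * q powi (2 * j * e))"
proof -
  have "inj_on (\<lambda>e. q powi (2 * e)) D"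
    by (simp add: inj_on_def q_powi_eq_iff)
  then obtain k where k: "\<And>j. j < 2 * b + 1 \<Longrightarrow>
      (q powi (2 * a)) ^ j = (\<Sum>e\<in>D. k e * (q powi (2 * e)) ^ j)"
    using lagrange_weights[OF assms(1), of "\<lambda>e. q powi (2 * e)" "q powi (2 * a)"] assms(2) by auto
  show ?thesis
  proof (intro exI allI impI)
    fix j assume j: "- int b \<le> j" "j \<le> int b"
    define i where "i = nat (j + int b)"
    have i: "j = int i - int b" "i < 2 * b + 1"
      using j by (auto simp: i_def)
    have shift: "q powi (2 * j * e) = q powi (- 2 * int b * e) * (q powi (2 * e)) ^ i" for e
      using q_nonzero by (simp add: i(1) algebra_simps power_int_power' flip: power_int_add)
    have "q powi (2 * j * a) = q powi (- 2 * int b * a) * (\<Sum>e\<in>D. k e * (q powi (2 * e)) ^ i)"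
      unfolding shift[of a] k[OF i(2)] ..
    also have "\<dots> = (\<Sum>e\<in>D. (k e * q powi (2 * int b * (e - a))) * q powi (2 * j * e))"
      unfolding sum_distrib_left
    proof (rule sum.cong)
      fix e
      have "q powi (- 2 * int b * a) = q powi (2 * int b * (e - a)) * q powi (- 2 * int b * e)"
        using q_nonzero by (simp add: algebra_simps flip: power_int_add)
      then show "q powi (- 2 * int b * a) * (k e * (q powi (2 * e)) ^ i) =
          k e * q powi (2 * int b * (e - a)) * q powi (2 * j * e)"
        unfolding shift[of e] by (simp add: mult_ac)
    qed simp
    finally show "q powi (2 * j * a) =
        (\<Sum>e\<in>D. (k e * q powi (2 * int b * (e - a))) * q powi (2 * j * e))" .
  qed
qed

text \<open>
  By the Serre relation a polynomial in left and right multiplication by \<open>A\<close> annihilates \<open>B\<^sup>b\<close> as soon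
  as it vanishes at the \<open>2b + 1\<close> points \<open>q\<^sup>2\<^sup>j\<close> with \<open>-b \<le> j \<le> b\<close>. On these points every power is a combination
  of any \<open>2b + 1\<close> chosen ones, and here the \<open>b\<close> smallest and the \<open>b + 1\<close> largest exponents are chosen. The
  set of points is invariant under inversion, so the same weights serve for the reversed words.
\<close>

lemma exchange:
  assumes "b \<le> a" "b < c"
  obtains k where
    "\<And>A B v. endo A \<Longrightarrow> endo B \<Longrightarrow> serre A B \<Longrightarrow>
       (A ^^ a) ((B ^^ b) ((A ^^ c) v)) =
       (\<Sum>e\<in>{..<b} \<union> {a + c - b..a + c}. k e *s (A ^^ e) ((B ^^ b) ((A ^^ (a + c - e)) v)))"
    "\<And>A B v. endo A \<Longrightarrow> endo B \<Longrightarrow> serre A B \<Longrightarrow>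
       (A ^^ c) ((B ^^ b) ((A ^^ a) v)) =
       (\<Sum>e\<in>{..<b} \<union> {a + c - b..a + c}. k e *s (A ^^ (a + c - e)) ((B ^^ b) ((A ^^ e) v)))"
proof -
  define m where "m = a + c"
  define D where "D = {..<b} \<union> {a + c - b..a + c}"
  have D: "finite D" "\<And>e. e \<in> D \<Longrightarrow> e \<le> m"
    using assms by (auto simp: D_def m_def)
  have "card D = card {..<b} + card {a + c - b..a + c}"
    unfolding D_def using assms by (intro card_Un_disjoint) auto
  then have "card (int ` D) = 2 * b + 1"
    using assms by (simp add: card_image)
  then obtain k where k: "\<And>j. - int b \<le> j \<Longrightarrow> j \<le> int b \<Longrightarrow>
      q powi (2 * j * int a) = (\<Sum>e\<in>int ` D. k e * q powi (2 * j * e))"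
    using q_interpolation[of "int ` D" b "int a"] D(1) by auto
  then have k: "q powi (2 * j * int a) = (\<Sum>e\<in>D. k (int e) * q powi (2 * j * int e))"
    if "- int b \<le> j" "j \<le> int b" for j
    using that by (simp add: sum.reindex)
  have pow: "(q powi (2 * j)) ^ n = q powi (2 * j * int n)" for j n
    by (simp add: power_int_power')
  show ?thesis
  proof
    fix A B v assume AB: "endo A" "endo B" "serre A B"
    note kill = killed_imp_sandwich_zero[OF AB(1) serre_power[OF AB]]
    have "sandwich A m (monom 1 a - (\<Sum>e\<in>D. monom (k (int e)) e)) (B ^^ b) v = 0"
    proof (rule kill)
      show "degree (monom 1 a - (\<Sum>e\<in>D. monom (k (int e)) e)) \<le> m"
        using D by (intro degree_diff_le degree_sum_le order_trans[OF degree_monom_le]) (auto simp: m_def)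
    qed (simp add: poly_sum poly_monom pow k)
    moreover have "a \<le> m" by (simp add: m_def)
    ultimately show "(A ^^ a) ((B ^^ b) ((A ^^ c) v)) =
        (\<Sum>e\<in>{..<b} \<union> {a + c - b..a + c}. k (int e) *s (A ^^ e) ((B ^^ b) ((A ^^ (a + c - e)) v)))"
      using D(2) by (simp add: sandwich_diff sandwich_sum sandwich_monom flip: D_def m_def)
        (simp add: m_def D_def)
    have "sandwich A m (monom 1 c - (\<Sum>e\<in>D. monom (k (int e)) (m - e))) (B ^^ b) v = 0"
    proof (rule kill)
      show "degree (monom 1 c - (\<Sum>e\<in>D. monom (k (int e)) (m - e))) \<le> m"
        using D by (intro degree_diff_le degree_sum_le order_trans[OF degree_monom_le]) (auto simp: m_def)
      fix j assume "- int b \<le> j" "j < - int b + int (2 * b + 1)"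
      then have "q powi (2 * - j * int a) = (\<Sum>e\<in>D. k (int e) * q powi (2 * - j * int e))"
        by (intro k) auto
      then have "q powi (2 * j * int m) * q powi (2 * - j * int a) =
          (\<Sum>e\<in>D. k (int e) * (q powi (2 * j * int m) * q powi (2 * - j * int e)))"
        by (simp add: sum_distrib_left mult.left_commute)
      moreover have "q powi (2 * j * int m) * q powi (2 * - j * int a) = q powi (2 * j * int c)"
        using q_nonzero by (simp add: m_def algebra_simps flip: power_int_add)
      moreover have "q powi (2 * j * int m) * q powi (2 * - j * int e) = q powi (2 * j * int (m - e))"
        if "e \<in> D" for e
        using q_nonzero D(2)[OF that] by (simp add: of_nat_diff algebra_simps flip: power_int_add)
      ultimately show "poly (monom 1 c - (\<Sum>e\<in>D. monom (k (int e)) (m - e))) (q powi (2 * j)) = 0"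
        by (simp add: poly_sum poly_monom pow)
    qed
    moreover have "c \<le> m" by (simp add: m_def)
    ultimately show "(A ^^ c) ((B ^^ b) ((A ^^ a) v)) =
        (\<Sum>e\<in>{..<b} \<union> {a + c - b..a + c}. k (int e) *s (A ^^ (a + c - e)) ((B ^^ b) ((A ^^ e) v)))"
      using D(2) by (simp add: sandwich_diff sandwich_sum sandwich_monom flip: D_def m_def)
        (simp add: m_def D_def)
  qed
qed

end

section \<open>Weight modules and their Borel subalgebra\<close>

context q_vector_space
begin

text \<open>
  The value at \<open>f\<close> of the polynomial with roots \<open>cs\<close>. Such polynomials produce the projections to
  eigenspaces, and they preserve every \<open>f\<close>-stable subspace.
\<close>

definition shift_prod :: "('v \<Rightarrow> 'v) \<Rightarrow> 'k list \<Rightarrow> 'v \<Rightarrow> 'v" where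
  "shift_prod f cs = foldr (\<lambda>c v. f v - c *s v) cs"

lemma shift_prod_simps [simp]:
  "shift_prod f [] v = v"
  "shift_prod f (c # cs) v = f (shift_prod f cs v) - c *s shift_prod f cs v"
  by (simp_all add: shift_prod_def)

lemma endo_shift_prod: "endo f \<Longrightarrow> endo (shift_prod f cs)"
  by (induction cs) (simp_all add: endo_iff algebra_simps)

lemma shift_prod_stable:
  assumes "subspace W" "f ` W \<subseteq> W" "w \<in> W"
  shows "shift_prod f cs w \<in> W"
  using assms by (induction cs) (auto intro!: subspace_diff subspace_scale)

lemma shift_prod_eigenvector:
  assumes "endo f" "f u = c *s u"
  shows "shift_prod f cs u = prod_list (map (\<lambda>e. c - e) cs) *s u"
  using assms by (induction cs) (simp_all add: endo_simps algebra_simps)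

lemma shift_prod_intertwine:
  assumes "endo f" "endo g" "\<And>v. g (f v) = c *s g v"
  shows "g (shift_prod f cs v) = prod_list (map (\<lambda>e. c - e) cs) *s g v"
  using assms by (induction cs) (simp_all add: endo_simps algebra_simps)

lemma shift_prod_commute:
  assumes "endo f"
  shows "f (shift_prod f cs v) = shift_prod f cs (f v)"
  using assms by (induction cs) (simp_all add: endo_simps)

definition weight_space :: "('v \<Rightarrow> 'v) \<Rightarrow> int \<Rightarrow> 'v set" where
  "weight_space f n = {v. f v = q powi n *s v}"

lemma subspace_weight_space: "endo f \<Longrightarrow> subspace (weight_space f n)"
  by (auto simp: subspace_def weight_space_def endo_simps scale_right_distrib mult.commute)

definition q_num :: "int \<Rightarrow> 'k" where
  "q_num n = (q powi n - q powi (- n)) / (q - inverse q)"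

lemma q_minus_inverse: "q - inverse q \<noteq> 0"
proof
  assume "q - inverse q = 0"
  then have "q powi 1 = q powi (- 1)" by simp
  then show False by (simp only: q_powi_eq_iff)
qed

lemma q_num_zero_iff: "q_num n = 0 \<longleftrightarrow> n = 0"
  using q_minus_inverse by (simp add: q_num_def q_powi_eq_iff)

lemma q_num_telescope: "q_num j * q_num (n + j - 1) + q_num (n + 2 * j) = q_num (j + 1) * q_num (n + j)"
proof -
  define e x y where "e = q - inverse q" and "x = q powi n" and "y = q powi j"
  have nz: "e \<noteq> 0" "x \<noteq> 0" "y \<noteq> 0"
    using q_minus_inverse q_nonzero by (simp_all add: e_def x_def y_def)
  have pow: "q powi (n + j - 1) = x * y / q" "q powi (- (n + j - 1)) = q / (x * y)"
    "q powi (n + 2 * j) = x * y * y" "q powi (- (n + 2 * j)) = 1 / (x * y * y)"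
    "q powi (j + 1) = y * q" "q powi (- (j + 1)) = 1 / (y * q)"
    "q powi (n + j) = x * y" "q powi (- (n + j)) = 1 / (x * y)" "q powi (- j) = 1 / y"
    using q_nonzero power_int_add[of q j j]
    by (simp_all add: x_def y_def power_int_minus power_int_add power_int_diff inverse_eq_divide flip: mult_2)
  have "(y - 1 / y) * (x * y / q - q / (x * y)) + (x * y * y - 1 / (x * y * y)) * e
      = (y * q - 1 / (y * q)) * (x * y - 1 / (x * y))"
    using nz q_nonzero by (simp add: e_def field_simps)
  moreover have "a / e * (b / e) + c / e = u / e * (w / e)" if "a * b + c * e = u * w" for a b c u w
    using that nz(1) by (simp add: field_simps)
  ultimately show ?thesis
    unfolding q_num_def e_def[symmetric] pow y_def[symmetric] by blast
qed

end

text \<open>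
  The data that remain of a module of type \<open>(1, 1)\<close>: \<open>R\<close> and \<open>L\<close> are the actions of $e_0^+$ and $e_1^+$,
  \<open>Rm\<close> and \<open>Lm\<close> those of $e_0^-$ and $e_1^-$, and \<open>T\<close> is the action of $K_0$, whose inverse \<open>T'\<close> is also the
  action of $K_1$. The relations are symmetric in the two nodes, see \<open>swap\<close> below.
\<close>

locale weight_module = q_vector_space scale q
  for scale :: "'k::field \<Rightarrow> 'v::ab_group_add \<Rightarrow> 'v" (infixr \<open>*s\<close> 75) and q :: 'k +
  fixes d :: nat and R L Rm Lm T T' :: "'v \<Rightarrow> 'v"
  assumes endo_gens: "endo R" "endo L" "endo Rm" "endo Lm" "endo T" "endo T'"
    and T_inverse: "T (T' v) = v" "T' (T v) = v"
    and T_R: "T (R v) = q powi 2 *s R (T v)"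
    and T_L: "T (L v) = q powi (- 2) *s L (T v)"
    and T_Rm: "T (Rm v) = q powi (- 2) *s Rm (T v)"
    and T_Lm: "T (Lm v) = q powi 2 *s Lm (T v)"
    and R_Rm: "R (Rm v) - Rm (R v) = (1 / (q - inverse q)) *s (T v - T' v)"
    and L_Lm: "L (Lm v) - Lm (L v) = (1 / (q - inverse q)) *s (T' v - T v)"
    and serre_RL: "serre R L" and serre_LR: "serre L R"
    and weights: "\<exists>u. (\<forall>i\<le>d. u i \<in> weight_space T (2 * int i - int d)) \<and> v = (\<Sum>i\<le>d. u i)"
    and weight_nonzero: "i \<le> d \<Longrightarrow> weight_space T (2 * int i - int d) \<noteq> {0}"
    and irreducible: "subspace W \<Longrightarrow> R ` W \<subseteq> W \<Longrightarrow> L ` W \<subseteq> W \<Longrightarrow> Rm ` W \<subseteq> W \<Longrightarrow> Lm ` W \<subseteq> W \<Longrightarrow>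
      T ` W \<subseteq> W \<Longrightarrow> T' ` W \<subseteq> W \<Longrightarrow> W = {0} \<or> W = UNIV"
    and finite_dim: "\<exists>B. finite B \<and> span B = UNIV"
begin

abbreviation wt :: "int \<Rightarrow> 'v set" where
  "wt n \<equiv> weight_space T n"

lemma T_wt: "v \<in> wt n \<Longrightarrow> T v = q powi n *s v"
  by (simp add: weight_space_def)

lemma T'_wt:
  assumes "v \<in> wt n"
  shows "T' v = q powi (- n) *s v"
proof -
  have "v = q powi n *s T' v"
    using assms T_inverse(2)[of v] endo_gens by (simp add: weight_space_def endo_simps)
  then have "q powi (- n) *s v = (q powi (- n) * q powi n) *s T' v"
    by (metis scale_scale)
  then show ?thesis
    using q_nonzero by (simp flip: power_int_add)
qed

lemma T'_weight_space: "weight_space T' n = wt (- n)"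
proof (intro equalityI subsetI)
  fix v assume "v \<in> wt (- n)"
  then show "v \<in> weight_space T' n"
    using T'_wt[of v "- n"] by (simp add: weight_space_def)
next
  fix v assume v: "v \<in> weight_space T' n"
  then have "v = q powi n *s T v"
    using T_inverse(1)[of v] endo_gens by (simp add: weight_space_def endo_simps)
  then have "q powi (- n) *s v = (q powi (- n) * q powi n) *s T v"
    by (metis scale_scale)
  then show "v \<in> wt (- n)"
    using q_nonzero by (simp add: weight_space_def flip: power_int_add)
qed

lemma subspace_wt: "subspace (wt n)"
  using subspace_weight_space endo_gens(5) by blast

lemma R_wt: "v \<in> wt n \<Longrightarrow> R v \<in> wt (n + 2)"
  and L_wt: "v \<in> wt n \<Longrightarrow> L v \<in> wt (n - 2)"
  and Rm_wt: "v \<in> wt n \<Longrightarrow> Rm v \<in> wt (n - 2)"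
  using endo_gens q_nonzero
  by (simp_all add: weight_space_def T_R T_L T_Rm T_Lm endo_simps power_int_add power_int_diff
      power_int_minus divide_simps mult.commute)

lemma R_pow_wt: "v \<in> wt n \<Longrightarrow> (R ^^ i) v \<in> wt (n + 2 * int i)"
  by (induction i) (auto dest: R_wt simp: algebra_simps)

lemma L_pow_wt: "v \<in> wt n \<Longrightarrow> (L ^^ i) v \<in> wt (n - 2 * int i)"
  by (induction i) (auto dest: L_wt simp: algebra_simps)

lemma Rm_pow_wt: "v \<in> wt n \<Longrightarrow> (Rm ^^ i) v \<in> wt (n - 2 * int i)"
  by (induction i) (auto dest: Rm_wt simp: algebra_simps)

text \<open>
  The exchange of the two nodes. It turns every statement about \<open>R\<close>, \<open>Rm\<close> and \<open>x\<close> into one about \<open>L\<close>,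
  \<open>Lm\<close> and \<open>y\<close>, with the weights negated.
\<close>

lemma swap: "weight_module scale q d L R Lm Rm T' T"
proof (rule weight_module.intro[OF q_vector_space_axioms weight_module_axioms.intro])
  show "T' (L v) = q powi 2 *s L (T' v)" for v
    using T_L[of "T' v"] T_inverse endo_gens q_nonzero
    by (metis (no_types, lifting) endo_scale minus_minus power_int_minus right_inverse
        power_int_not_zero scale_one scale_scale)
  show "T' (R v) = q powi (- 2) *s R (T' v)" for v
    using T_R[of "T' v"] T_inverse endo_gens q_nonzero
    by (metis (no_types, lifting) endo_scale power_int_minus left_inverse
        power_int_not_zero scale_one scale_scale)
  show "T' (Lm v) = q powi (- 2) *s Lm (T' v)" for v
    using T_Lm[of "T' v"] T_inverse endo_gens q_nonzero
    by (metis (no_types, lifting) endo_scale power_int_minus left_inverse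
        power_int_not_zero scale_one scale_scale)
  show "T' (Rm v) = q powi 2 *s Rm (T' v)" for v
    using T_Rm[of "T' v"] T_inverse endo_gens q_nonzero
    by (metis (no_types, lifting) endo_scale minus_minus power_int_minus right_inverse
        power_int_not_zero scale_one scale_scale)
  show "\<exists>u. (\<forall>i\<le>d. u i \<in> weight_space T' (2 * int i - int d)) \<and> v = (\<Sum>i\<le>d. u i)" for v
  proof -
    obtain u where u: "\<forall>i\<le>d. u i \<in> wt (2 * int i - int d)" "v = (\<Sum>i\<le>d. u i)"
      using weights by blast
    have "u (d - i) \<in> weight_space T' (2 * int i - int d)" if "i \<le> d" for i
      using u(1)[rule_format, of "d - i"] that by (simp add: T'_weight_space of_nat_diff)
    moreover have "v = (\<Sum>i\<le>d. u (d - i))"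
      unfolding u(2) by (rule sum.reindex_bij_witness[of _ "\<lambda>i. d - i" "\<lambda>i. d - i"]) auto
    ultimately show ?thesis by (intro exI[of _ "\<lambda>i. u (d - i)"]) simp
  qed
  show "weight_space T' (2 * int i - int d) \<noteq> {0}" if "i \<le> d" for i
    using weight_nonzero[of "d - i"] that by (simp add: T'_weight_space of_nat_diff)
  show "W = {0} \<or> W = UNIV" if "subspace W" "L ` W \<subseteq> W" "R ` W \<subseteq> W" "Lm ` W \<subseteq> W" "Rm ` W \<subseteq> W"
    "T' ` W \<subseteq> W" "T ` W \<subseteq> W" for W
    using irreducible that by blast
qed (use endo_gens T_inverse R_Rm L_Lm serre_RL serre_LR finite_dim in simp_all)

text \<open>
  The projection to the weight space of weight \<open>2 i - d\<close>. As a polynomial in \<open>T\<close> it is linear and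
  preserves \<open>T\<close>-stable subspaces. For \<open>i > d\<close> all eigenvalues of \<open>T\<close> are among the roots of the polynomial, and
  so the value is zero.
\<close>

definition proj :: "nat \<Rightarrow> 'v \<Rightarrow> 'v" where
  "proj i v =
    (let cs = [q powi (2 * int j - int d). j \<leftarrow> [0..<Suc d], j \<noteq> i] in
       inverse (prod_list (map (\<lambda>c. q powi (2 * int i - int d) - c) cs)) *s shift_prod T cs v)"

lemma endo_proj: "endo (proj i)"
  using endo_shift_prod[OF endo_gens(5)]
  by (simp add: proj_def Let_def endo_iff algebra_simps)

lemma proj_stable: "subspace W \<Longrightarrow> T ` W \<subseteq> W \<Longrightarrow> w \<in> W \<Longrightarrow> proj i w \<in> W"
  unfolding proj_def Let_def by (intro subspace_scale shift_prod_stable) auto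

lemma proj_weight:
  assumes "v \<in> wt (2 * int k - int d)" "k \<le> d"
  shows "proj i v = (if i = k then v else 0)"
proof -
  define cs where "cs = [q powi (2 * int j - int d). j \<leftarrow> [0..<Suc d], j \<noteq> i]"
  have p: "proj i v = inverse (prod_list (map (\<lambda>c. q powi (2 * int i - int d) - c) cs)) *s shift_prod T cs v"
    by (simp only: proj_def Let_def cs_def)
  have *: "shift_prod T cs v = prod_list (map (\<lambda>c. q powi (2 * int k - int d) - c) cs) *s v"
    using shift_prod_eigenvector[OF endo_gens(5) T_wt[OF assms(1)]] .
  show ?thesis
  proof (cases "i = k")
    case True
    have "prod_list (map (\<lambda>c. q powi (2 * int i - int d) - c) cs) \<noteq> 0"
      by (auto simp: cs_def prod_list_zero_iff q_powi_eq_iff simp del: upt_Suc)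
    then show ?thesis
      using True * p by simp
  next
    case False
    have "q powi (2 * int k - int d) \<in> set cs"
      using False assms(2) by (auto simp: cs_def simp del: upt_Suc)
    then have "prod_list (map (\<lambda>c. q powi (2 * int k - int d) - c) cs) = 0"
      by (auto simp: prod_list_zero_iff)
    then show ?thesis
      using False * p by simp
  qed
qed

lemma
  shows proj_in_wt: "i \<le> d \<Longrightarrow> proj i v \<in> wt (2 * int i - int d)"
    and sum_proj: "(\<Sum>i\<le>d. proj i v) = v"
proof -
  obtain u where u: "\<forall>i\<le>d. u i \<in> wt (2 * int i - int d)" "v = (\<Sum>i\<le>d. u i)"
    using weights by blast
  have *: "proj i v = u i" if "i \<le> d" for i
  proof -
    have "proj i v = (\<Sum>k\<le>d. if k = i then u k else 0)"
      unfolding u(2) endo_sum[OF endo_proj] by (rule sum.cong) (use u(1) proj_weight in auto)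
    then show ?thesis using that by simp
  qed
  show "i \<le> d \<Longrightarrow> proj i v \<in> wt (2 * int i - int d)"
    using * u(1) by simp
  show "(\<Sum>i\<le>d. proj i v) = v"
    using * u(2) by simp
qed

lemma wt_trivial:
  assumes "v \<in> wt n" "\<And>i. i \<le> d \<Longrightarrow> n \<noteq> 2 * int i - int d"
  shows "v = 0"
proof -
  have "proj i v = 0" if i: "i \<le> d" for i
  proof -
    have "T (proj i v) = proj i (T v)"
      using endo_gens by (simp add: proj_def Let_def endo_simps shift_prod_commute)
    then have "q powi (2 * int i - int d) *s proj i v = q powi n *s proj i v"
      using T_wt[OF proj_in_wt[OF i]] T_wt[OF assms(1)] endo_scale[OF endo_proj] by metis
    then have "q powi (2 * int i - int d) = q powi n \<or> proj i v = 0"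
      by simp
    then show ?thesis
      using assms(2)[OF i] by (auto simp: q_powi_eq_iff)
  qed
  then show ?thesis
    using sum_proj[of v] by simp
qed

lemma wt_trivial_outside:
  assumes "v \<in> wt n" "n < - int d \<or> n > int d"
  shows "v = 0"
  using assms by (intro wt_trivial) auto

lemma proj_wt:
  assumes "v \<in> wt n" "i \<le> d"
  shows "proj i v = (if n = 2 * int i - int d then v else 0)"
proof (cases "\<exists>k\<le>d. n = 2 * int k - int d")
  case True
  then show ?thesis
    using assms proj_weight by auto
next
  case False
  then have "v = 0" using assms(1) wt_trivial by blast
  then show ?thesis using endo_zero[OF endo_proj] by simp
qed

text \<open>
  The \<open>sl\<^sub>2\<close> commutation formula. For \<open>j = 0\<close> the coefficient vanishes, so the exponent \<open>j - 1\<close> does no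
  harm.
\<close>

lemma Rm_R_pow:
  assumes "v \<in> wt n"
  shows "Rm ((R ^^ j) v) = (R ^^ j) (Rm v) - (q_num (int j) * q_num (n + int j - 1)) *s (R ^^ (j - 1)) v"
proof (induction j)
  case 0
  show ?case by (simp add: q_num_def)
next
  case (Suc j)
  let ?w = "(R ^^ j) v"
  have w: "?w \<in> wt (n + 2 * int j)"
    using R_pow_wt[OF assms] .
  have "(1 / (q - inverse q)) *s (T ?w - T' ?w) = q_num (n + 2 * int j) *s ?w"
    unfolding T_wt[OF w] T'_wt[OF w]
    by (simp add: q_num_def algebra_simps diff_divide_distrib)
  then have "Rm (R ?w) = R (Rm ?w) - q_num (n + 2 * int j) *s ?w"
    using R_Rm[of ?w] by (simp add: algebra_simps)
  also have "R (Rm ?w) = (R ^^ Suc j) (Rm v) - (q_num (int j) * q_num (n + int j - 1)) *s R ((R ^^ (j - 1)) v)"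
    unfolding Suc.IH using endo_gens by (simp add: endo_simps)
  also have "(q_num (int j) * q_num (n + int j - 1)) *s R ((R ^^ (j - 1)) v) =
      (q_num (int j) * q_num (n + int j - 1)) *s ?w"
    by (cases j) (simp_all add: q_num_def)
  also have "(R ^^ Suc j) (Rm v) - (q_num (int j) * q_num (n + int j - 1)) *s ?w - q_num (n + 2 * int j) *s ?w
     = (R ^^ Suc j) (Rm v) - (q_num (int j) * q_num (n + int j - 1) + q_num (n + 2 * int j)) *s ?w"
    by (simp add: algebra_simps)
  finally show ?case
    using q_num_telescope[of "int j" n] by (simp add: ac_simps)
qed

text \<open>
  Induction on the number of times that \<open>Rm\<close> can be applied. The vector \<open>Rm v\<close> satisfies the
  hypotheses with \<open>k + 2\<close> and \<open>n + 1\<close>, so it is zero. Then \<open>v\<close> is a lowest weight vector, and \<open>Rm\<close> leads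
  from \<open>R\<^sup>n v\<close> back to a nonzero multiple of \<open>v\<close>.
\<close>

lemma R_pow_injective:
  assumes "v \<in> wt (- k)" "(R ^^ n) v = 0" "int n \<le> k"
  shows "v = 0"
proof -
  have "(Rm ^^ (nat (int d + 1))) v = 0"
    by (rule wt_trivial_outside[OF Rm_pow_wt[OF assms(1)]]) (use assms(3) in auto)
  then obtain m where "(Rm ^^ m) v = 0" by blast
  then show ?thesis
    using assms
  proof (induction m arbitrary: v k n)
    case (Suc m)
    have "Rm v \<in> wt (- (k + 2))"
      using Rm_wt[OF Suc.prems(2)] by (simp add: algebra_simps)
    moreover have "(R ^^ Suc n) (Rm v) = 0"
      using Rm_R_pow[OF Suc.prems(2), of "Suc n"] Suc.prems(3) endo_gens by (simp add: endo_simps)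
    ultimately have Rm: "Rm v = 0"
      using Suc.IH[of "Rm v" "k + 2" "Suc n"] Suc.prems by (simp add: funpow_swap1)
    show ?case
      using Suc.prems(3,4)
    proof (induction n)
      case (Suc n)
      have "(q_num (int (Suc n)) * q_num (- k + int (Suc n) - 1)) *s (R ^^ n) v = 0"
        using Rm_R_pow[OF \<open>v \<in> wt (- k)\<close>, of "Suc n"] Suc.prems(1) Rm
          endo_zero[OF endo_funpow[OF endo_gens(1)]] endo_zero[OF endo_gens(3)] endo_zero[OF endo_gens(1)]
        by simp
      then have "(R ^^ n) v = 0"
        using Suc.prems(2) q_num_zero_iff by auto
      then show ?case
        using Suc by simp
    qed simp
  qed simp
qed

lemma lowest_weight_vector:
  assumes "v \<in> wt (- int k)" "(R ^^ Suc k) v = 0"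
  shows "Rm v = 0"
proof (rule R_pow_injective)
  show "Rm v \<in> wt (- (int k + 2))"
    using Rm_wt[OF assms(1)] by (simp add: algebra_simps)
  have "(R ^^ Suc (Suc k)) v = 0"
    using assms(2) endo_gens by (simp add: endo_simps)
  then show "(R ^^ Suc (Suc k)) (Rm v) = 0"
    using Rm_R_pow[OF assms(1), of "Suc (Suc k)"] assms(2) endo_gens by (simp add: endo_simps)
qed simp

lemma subspace_dim_equal_of_injections:
  assumes "subspace S" "subspace S'" "endo f" "endo g" "f ` S \<subseteq> S'" "g ` S' \<subseteq> S"
    and "\<And>v. v \<in> S \<Longrightarrow> f v = 0 \<Longrightarrow> v = 0" "\<And>v. v \<in> S' \<Longrightarrow> g v = 0 \<Longrightarrow> v = 0"
  shows "f ` S = S'"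
proof -
  obtain B where B: "finite B" "span B = UNIV"
    using finite_dim by blast
  obtain C where C: "C \<subseteq> B" "independent C" "UNIV \<subseteq> span C"
    using maximal_independent_subset[of B] B by (metis span_mono span_span)
  interpret fd: finite_dimensional_vector_space scale C
    using C B(1) finite_subset by unfold_locales auto
  interpret pr: finite_dimensional_vector_space_pair scale C scale C
    by unfold_locales
  have inj: "inj_on h S''" if "endo h" "subspace S''" "\<And>v. v \<in> S'' \<Longrightarrow> h v = 0 \<Longrightarrow> v = 0" for h S''
  proof (rule inj_onI)
    fix v w assume "v \<in> S''" "w \<in> S''" "h v = h w"
    then show "v = w"
      using that(3)[of "v - w"] that(1,2) by (simp add: subspace_diff endo_diff)
  qed
  have dim: "dim (h ` S'') = dim S''" if "endo h" "subspace S''" "\<And>v. v \<in> S'' \<Longrightarrow> h v = 0 \<Longrightarrow> v = 0" for h S''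
    using that inj by (intro pr.dim_image_eq) (auto simp: span_eq_iff[THEN iffD2])
  have "dim S' = dim (g ` S')"
    using dim assms by simp
  also have "\<dots> \<le> dim S"
    using assms by (intro fd.dim_subset)
  also have "\<dots> = dim (f ` S)"
    using dim assms by simp
  finally show ?thesis
    using assms by (intro fd.subspace_dim_equal) (auto intro: pr.linear_subspace_image)
qed

lemma T_stable_imp_T'_stable:
  assumes "subspace W" "T ` W \<subseteq> W"
  shows "T' ` W \<subseteq> W"
proof clarify
  fix w assume w: "w \<in> W"
  have "T' w = T' (\<Sum>i\<le>d. proj i w)"
    by (simp add: sum_proj)
  also have "\<dots> = (\<Sum>i\<le>d. q powi (- (2 * int i - int d)) *s proj i w)"
    unfolding endo_sum[OF endo_gens(6)] by (intro sum.cong refl T'_wt proj_in_wt) simp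
  also have "\<dots> \<in> W"
    using assms w by (intro subspace_sum subspace_scale proj_stable)
  finally show "T' w \<in> W" .
qed

text \<open>
  \<open>R\<^sup>k\<close> and \<open>L\<^sup>k\<close> map the two weight spaces of \<open>W\<close> injectively into each other, so these have the same
  finite dimension.
\<close>

lemma R_pow_surjective_on_stable:
  assumes W: "subspace W" "R ` W \<subseteq> W" "L ` W \<subseteq> W" and w: "w \<in> W" "w \<in> wt (int k)"
  shows "\<exists>w'\<in>W \<inter> wt (- int k). (R ^^ k) w' = w"
proof -
  interpret sw: weight_module scale q d L R Lm Rm T' T
    by (rule swap)
  have pow: "(f ^^ k) v \<in> W" if "f ` W \<subseteq> W" "v \<in> W" for f v
    using that by (induction k) auto
  have "(R ^^ k) ` (W \<inter> wt (- int k)) = W \<inter> wt (int k)"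
  proof (rule subspace_dim_equal_of_injections)
    show "subspace (W \<inter> wt (- int k))" "subspace (W \<inter> wt (int k))"
      using W subspace_wt by (auto intro: subspace_inter)
    show "endo (R ^^ k)" "endo (L ^^ k)"
      using endo_gens endo_funpow by auto
    show "(R ^^ k) ` (W \<inter> wt (- int k)) \<subseteq> W \<inter> wt (int k)"
      using pow[OF W(2)] R_pow_wt[of _ "- int k" k] by auto
    show "(L ^^ k) ` (W \<inter> wt (int k)) \<subseteq> W \<inter> wt (- int k)"
      using pow[OF W(3)] L_pow_wt[of _ "int k" k] by auto
    show "v = 0" if "v \<in> W \<inter> wt (- int k)" "(R ^^ k) v = 0" for v
      using that R_pow_injective[of v "int k" k] by simp
    show "v = 0" if "v \<in> W \<inter> wt (int k)" "(L ^^ k) v = 0" for v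
      using that sw.R_pow_injective[of v "int k" k] by (simp add: T'_weight_space)
  qed
  then show ?thesis
    using w by (metis IntI imageE)
qed

text \<open>
  In a weight \<open>-k \<le> 0\<close> an element of \<open>W\<close> differs by some \<open>R w'\<close> with \<open>w' \<in> W\<close> from one that is killed by
  \<open>R\<^sup>k\<^sup>+\<^sup>1\<close>, that is, from a lowest weight vector. So \<open>Rm\<close> of it can be computed from \<open>Rm w'\<close>, where the
  weight of \<open>w'\<close> is smaller. The elements of positive weight are \<open>R\<^sup>k w'\<close> with \<open>w'\<close> of weight \<open>-k\<close>.
\<close>

lemma borel_stable_imp_Rm_stable:
  assumes W: "subspace W" "R ` W \<subseteq> W" "L ` W \<subseteq> W" "T ` W \<subseteq> W"
  shows "Rm ` W \<subseteq> W"
proof -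
  have pow: "(R ^^ j) v \<in> W" if "v \<in> W" for v j
    using that W(2) by (induction j) auto
  have low: "Rm w \<in> W" if "w \<in> W" "w \<in> wt (- int k)" for w k
    using that
  proof (induction "d + 2 - k" arbitrary: k w rule: less_induct)
    case less
    show ?case
    proof (cases "k > d")
      case True
      then have "w = 0"
        using less.prems wt_trivial_outside by fastforce
      then show ?thesis
        using W(1) endo_zero[OF endo_gens(3)] subspace_0 by simp
    next
      case False
      have "(R ^^ Suc k) w \<in> wt (int (Suc (Suc k)))"
        using R_pow_wt[OF less.prems(2), of "Suc k"] by (simp add: algebra_simps)
      then obtain w' where w': "w' \<in> W" "w' \<in> wt (- int (Suc (Suc k)))"
        "(R ^^ Suc (Suc k)) w' = (R ^^ Suc k) w"
        using R_pow_surjective_on_stable[OF W(1-3) pow[OF less.prems(1)]] by blast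
      have "R w' \<in> wt (- int k)"
        using R_wt[OF w'(2)] by (simp add: algebra_simps)
      then have "w - R w' \<in> wt (- int k)"
        using less.prems(2) subspace_wt subspace_diff by blast
      moreover have "(R ^^ Suc k) (w - R w') = 0"
        using w'(3) endo_diff[OF endo_funpow[OF endo_gens(1)], of "Suc k" w "R w'"]
        by (simp add: funpow_swap1)
      ultimately have "Rm (w - R w') = 0"
        by (rule lowest_weight_vector)
      then have "Rm w = Rm (R w')"
        using endo_diff[OF endo_gens(3)] by simp
      also have "\<dots> = R (Rm w') - (q_num 1 * q_num (- int (Suc (Suc k)))) *s w'"
        using Rm_R_pow[OF w'(2), of 1] by simp
      also have "\<dots> \<in> W"
      proof -
        have "Rm w' \<in> W"
          by (rule less(1)[OF _ w'(1,2)]) (use False in auto)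
        then show ?thesis
          using W(1,2) w'(1) by (intro subspace_diff subspace_scale) auto
      qed
      finally show ?thesis .
    qed
  qed
  have homogeneous: "Rm w \<in> W" if w: "w \<in> W" "w \<in> wt n" for w n
  proof (cases "n \<le> 0")
    case True
    then show ?thesis
      using low[of w "nat (- n)"] w by simp
  next
    case False
    define k where "k = nat n"
    have k: "n = int k" using False by (simp add: k_def)
    obtain w' where w': "w' \<in> W" "w' \<in> wt (- int k)" "(R ^^ k) w' = w"
      using R_pow_surjective_on_stable[OF W(1-3) w(1)] w(2) k by blast
    show ?thesis
      unfolding w'(3)[symmetric] Rm_R_pow[OF w'(2)]
      using W(1) pow low w' by (intro subspace_diff subspace_scale) auto
  qed
  show ?thesis
  proof clarify
    fix w assume w: "w \<in> W"
    have hom: "Rm (proj i w) \<in> W" if "i \<le> d" for i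
      by (rule homogeneous[OF proj_stable[OF W(1,4) w] proj_in_wt[OF that]])
    have "Rm w = (\<Sum>i\<le>d. Rm (proj i w))"
      using endo_sum[OF endo_gens(3), of "\<lambda>i. proj i w" "{..d}"] by (simp add: sum_proj)
    also have "\<dots> \<in> W"
      using W(1) hom by (intro subspace_sum) auto
    finally show "Rm w \<in> W" .
  qed
qed

theorem borel_irreducible:
  assumes W: "subspace W" "R ` W \<subseteq> W" "L ` W \<subseteq> W" "T ` W \<subseteq> W"
  shows "W = {0} \<or> W = UNIV"
proof -
  interpret sw: weight_module scale q d L R Lm Rm T' T
    by (rule swap)
  have T': "T' ` W \<subseteq> W"
    using T_stable_imp_T'_stable W by blast
  show ?thesis
    using irreducible W T' borel_stable_imp_Rm_stable[OF W]
      sw.borel_stable_imp_Rm_stable[OF W(1,3,2) T'] by blast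
qed

end

section \<open>The operators \<open>L\<^sup>i R\<^sup>i\<close> on the lowest weight space\<close>

lemma first_ascent:
  fixes ls :: "nat list"
  assumes "\<not> sorted_wrt (\<ge>) ls"
  shows "\<exists>xs b c ys. ls = xs @ b # c # ys \<and> sorted_wrt (\<ge>) (xs @ [b]) \<and> b < c"
  using assms
proof (induction ls)
  case (Cons x ls)
  show ?case
  proof (cases ls)
    case Nil
    then show ?thesis using Cons.prems by simp
  next
    case (Cons y ys)
    show ?thesis
    proof (cases "x < y")
      case True
      then show ?thesis
        using \<open>ls = y # ys\<close> by (intro exI[of _ "[]"] exI[of _ x] exI[of _ y] exI[of _ ys]) simp
    next
      case False
      then have "\<not> sorted_wrt (\<ge>) ls"
        using Cons.prems \<open>ls = y # ys\<close> by fastforce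
      then obtain xs b c zs where *: "ls = xs @ b # c # zs" "sorted_wrt (\<ge>) (xs @ [b])" "b < c"
        using Cons.IH by blast
      have "sorted_wrt (\<ge>) ((x # xs) @ [b])"
        using *(1,2) False \<open>ls = y # ys\<close> by (cases xs) fastforce+
      then show ?thesis
        using *(1,3) by (intro exI[of _ "x # xs"] exI[of _ b] exI[of _ c] exI[of _ zs]) simp
    qed
  qed
qed simp

text \<open>
  Lexicographic comparison, with the first difference at a position of at most \<open>p\<close>.
\<close>

definition lex_larger :: "nat \<Rightarrow> nat list \<Rightarrow> nat list \<Rightarrow> bool" where
  "lex_larger p ms ls \<longleftrightarrow>
     (\<exists>i\<le>p. i < length ls \<and> take i ms = take i ls \<and> ls ! i < ms ! i)"

context weight_module
begin

text \<open>
  Let \<open>b < c\<close>. The exchange lemma expands the left side around the factor \<open>R\<^sup>b\<close>, and its reversed form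
  expands the right side around \<open>L\<^sup>b\<close> with the same weights. The terms with \<open>e < b\<close> vanish, as they pass
  below the lowest weight. The other terms are of the same form with \<open>c\<close> replaced by some \<open>n - e \<le> b\<close>, and
  they match by induction.
\<close>

lemma dyck_mirror:
  assumes "u \<in> wt (- int d)" "b + c \<le> n"
  shows "(L ^^ (n - c)) ((R ^^ b) ((L ^^ c) ((R ^^ (n - b)) u))) =
         (L ^^ (n - b)) ((R ^^ c) ((L ^^ b) ((R ^^ (n - c)) u)))"
proof -
  define D where "D b c = (L ^^ (n - c)) ((R ^^ b) ((L ^^ c) ((R ^^ (n - b)) u)))" for b c
  have 0: "(L ^^ i) 0 = 0" "(R ^^ i) 0 = 0" for i
    using endo_zero endo_funpow endo_gens by auto
  have *: "D b c = D c b" if "b < c" "b + c \<le> n" for b c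
    using that
  proof (induction b arbitrary: c rule: less_induct)
    case (less b)
    have n: "n - c + c = n"
      using less.prems by simp
    obtain k where k:
      "\<And>A B v. endo A \<Longrightarrow> endo B \<Longrightarrow> serre A B \<Longrightarrow> (A ^^ (n - c)) ((B ^^ b) ((A ^^ c) v)) =
         (\<Sum>e\<in>{..<b} \<union> {n - b..n}. k e *s (A ^^ e) ((B ^^ b) ((A ^^ (n - e)) v)))"
      "\<And>A B v. endo A \<Longrightarrow> endo B \<Longrightarrow> serre A B \<Longrightarrow> (A ^^ c) ((B ^^ b) ((A ^^ (n - c)) v)) =
         (\<Sum>e\<in>{..<b} \<union> {n - b..n}. k e *s (A ^^ (n - e)) ((B ^^ b) ((A ^^ e) v)))"
    proof (rule exchange[of b "n - c" c, unfolded n])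
      show "b \<le> n - c" "b < c" using less.prems by simp_all
    qed (rule that)
    have "D b c = (\<Sum>e\<in>{..<b} \<union> {n - b..n}.
        k e *s (L ^^ e) ((R ^^ b) ((L ^^ (n - e)) ((R ^^ (n - b)) u))))"
      unfolding D_def by (rule k(1)) (use endo_gens serre_LR in auto)
    also have "\<dots> = (\<Sum>e\<in>{..<b} \<union> {n - b..n}.
        k e *s (L ^^ (n - b)) ((R ^^ (n - e)) ((L ^^ b) ((R ^^ e) u))))"
    proof (rule sum.cong)
      fix e assume e: "e \<in> {..<b} \<union> {n - b..n}"
      show "k e *s (L ^^ e) ((R ^^ b) ((L ^^ (n - e)) ((R ^^ (n - b)) u))) =
          k e *s (L ^^ (n - b)) ((R ^^ (n - e)) ((L ^^ b) ((R ^^ e) u)))"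
      proof (cases "e < b")
        case True
        have "(L ^^ (n - e)) ((R ^^ (n - b)) u) = 0"
          by (rule wt_trivial_outside[OF L_pow_wt[OF R_pow_wt[OF assms(1)]]]) (use True less.prems in auto)
        moreover have "(L ^^ b) ((R ^^ e) u) = 0"
          by (rule wt_trivial_outside[OF L_pow_wt[OF R_pow_wt[OF assms(1)]]]) (use True in auto)
        ultimately show ?thesis
          using 0 by simp
      next
        case False
        then have e: "n - (n - e) = e" "n - e \<le> b" "n - e + b \<le> n"
          using e less.prems by auto
        have "D (n - e) b = D b (n - e)"
          using less.IH[of "n - e" b] e by (cases "n - e = b") auto
        then show ?thesis
          unfolding D_def e(1) by simp
      qed
    qed simp
    also have "\<dots> = (L ^^ (n - b)) (\<Sum>e\<in>{..<b} \<union> {n - b..n}. k e *s (R ^^ (n - e)) ((L ^^ b) ((R ^^ e) u)))"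
      by (simp only: endo_sum[OF endo_funpow[OF endo_gens(2)]] endo_scale[OF endo_funpow[OF endo_gens(2)]])
    also have "\<dots> = D c b"
      unfolding D_def by (subst k(2)) (use endo_gens serre_RL in auto)
    finally show ?case .
  qed
  have "D b c = D c b"
    using *[of b c] *[of c b] assms(2) by (cases b c rule: linorder_cases) auto
  then show ?thesis
    by (simp add: D_def)
qed

text \<open>
  The case \<open>b = j\<close>, \<open>c = i\<close>, \<open>n = i + j\<close> of the preceding lemma.
\<close>

lemma bottom_operators_commute:
  assumes "u \<in> wt (- int d)"
  shows "(L ^^ j) ((R ^^ j) ((L ^^ i) ((R ^^ i) u))) = (L ^^ i) ((R ^^ i) ((L ^^ j) ((R ^^ j) u)))"
  using dyck_mirror[OF assms, of j i "i + j"] by simp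

text \<open>
  The word \<open>L\<^sup>l\<^sup>1 R\<^sup>l\<^sup>2 L\<^sup>l\<^sup>3 \<dots>\<close>, starting with \<open>L\<close> if the flag is set. Exponents may be zero, so the
  exchange lemma never changes the number of syllables.
\<close>

fun zigzag :: "bool \<Rightarrow> nat list \<Rightarrow> 'v \<Rightarrow> 'v" where
  "zigzag t [] v = v"
| "zigzag t (l # ls) v = ((if t then L else R) ^^ l) (zigzag (\<not> t) ls v)"

text \<open>
  Half the weight by which the zigzag word raises a vector.
\<close>

fun rise :: "bool \<Rightarrow> nat list \<Rightarrow> int" where
  "rise t [] = 0"
| "rise t (l # ls) = (if t then - int l else int l) + rise (\<not> t) ls"

lemma zigzag_append: "zigzag t (xs @ ys) v = zigzag t xs (zigzag (t = even (length xs)) ys v)"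
  by (induction xs arbitrary: t) (auto simp: eq_commute)

lemma rise_append: "rise t (xs @ ys) = rise t xs + rise (t = even (length xs)) ys"
proof (induction xs arbitrary: t)
  case (Cons x xs)
  then show ?case by (cases t) auto
qed simp

lemma endo_zigzag: "endo (zigzag t ls)"
proof (induction ls arbitrary: t)
  case (Cons l ls)
  then show ?case
    using endo_comp[OF endo_funpow Cons[of "\<not> t"], of "if t then L else R" l] endo_gens by simp
qed (simp add: endo_iff)

lemma zigzag_wt: "v \<in> wt n \<Longrightarrow> zigzag t ls v \<in> wt (n + 2 * rise t ls)"
proof (induction ls arbitrary: t)
  case (Cons l ls)
  then show ?case
    using L_pow_wt[OF Cons(1)[of "\<not> t"], of l] R_pow_wt[OF Cons(1)[of "\<not> t"], of l]
    by (auto simp: algebra_simps)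
qed simp

lemma rise_decreasing: "sorted_wrt (\<ge>) ls \<Longrightarrow> rise True ls \<le> 0"
  by (induction ls rule: induct_list012) auto

lemma zigzag_exchange:
  assumes "b \<le> a" "b < c"
  shows "\<exists>k. \<forall>v. zigzag True (pre @ a # b # c # ys) v =
    (\<Sum>e\<in>{..<b} \<union> {a + c - b..a + c}. k e *s zigzag True (pre @ e # b # (a + c - e) # ys) v)"
proof -
  define t where "t = (True = even (length pre))"
  obtain k where k: "\<And>A B v. endo A \<Longrightarrow> endo B \<Longrightarrow> serre A B \<Longrightarrow> (A ^^ a) ((B ^^ b) ((A ^^ c) v)) =
       (\<Sum>e\<in>{..<b} \<union> {a + c - b..a + c}. k e *s (A ^^ e) ((B ^^ b) ((A ^^ (a + c - e)) v)))"
    by (rule exchange[OF assms]) (rule that)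
  have "zigzag t (a # b # c # ys) v =
      (\<Sum>e\<in>{..<b} \<union> {a + c - b..a + c}. k e *s zigzag t (e # b # (a + c - e) # ys) v)" for v
  proof (cases t)
    case True
    then show ?thesis
      using k[OF endo_gens(2,1) serre_LR] by simp
  next
    case False
    then show ?thesis
      using k[OF endo_gens(1,2) serre_RL] by simp
  qed
  then show ?thesis
    unfolding zigzag_append t_def[symmetric]
    by (intro exI[of _ k] allI) (simp only: endo_sum[OF endo_zigzag] endo_scale[OF endo_zigzag])
qed

text \<open>
  Exchanging around the first ascent \<open>b < c\<close> gives two kinds of words. Either the exponent before \<open>b\<close> has
  grown, and the word is lexicographically larger. Or it has become some \<open>e < b\<close>; then \<open>e < b\<close> is again
  the first ascent, one position further to the left, and induction replaces this word by words
  which are larger already before that position. At the left end of the word the second kind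
  vanishes for reasons of weight.
\<close>

lemma bottom_zigzag_ascent:
  assumes S: "subspace S" and u: "u \<in> wt (- int d)"
    and "sorted_wrt (\<ge>) (pre @ [a])" "b \<le> a" "b < c"
    and "rise True (pre @ a # b # c # ys) = 0"
    and "\<And>ms. length ms = length (pre @ a # b # c # ys) \<Longrightarrow> sum_list ms = sum_list (pre @ a # b # c # ys) \<Longrightarrow>
      rise True ms = 0 \<Longrightarrow> lex_larger (length pre) ms (pre @ a # b # c # ys) \<Longrightarrow> zigzag True ms u \<in> S"
  shows "zigzag True (pre @ a # b # c # ys) u \<in> S"
  using assms(3-)
proof (induction "length pre" arbitrary: pre a b c ys rule: less_induct)
  case less
  have rise: "rise True (pre @ e # b # (a + c - e) # ys) = 0" if "e \<le> a + c" for e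
    using less.prems(4) that by (simp add: rise_append of_nat_diff split: if_splits)
  have "zigzag True (pre @ e # b # (a + c - e) # ys) u \<in> S" if e: "e \<in> {..<b} \<union> {a + c - b..a + c}" for e
  proof (cases "e < b")
    case False
    have "lex_larger (length pre) (pre @ e # b # (a + c - e) # ys) (pre @ a # b # c # ys)"
      unfolding lex_larger_def using False e less.prems(3) by (intro exI[of _ "length pre"]) auto
    then show ?thesis
      using less.prems(5)[of "pre @ e # b # (a + c - e) # ys"] rise[of e] e False by auto
  next
    case True
    show ?thesis
    proof (cases pre rule: rev_cases)
      case Nil
      have "zigzag True ((a + c - e) # ys) u = 0"
        by (rule wt_trivial_outside[OF zigzag_wt[OF u]])
          (use rise[of e] True less.prems(2) Nil in auto)
      then have "zigzag True (pre @ e # b # (a + c - e) # ys) u = 0"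
        using endo_zero[OF endo_funpow[OF endo_gens(1)]] endo_zero[OF endo_funpow[OF endo_gens(2)]] Nil by simp
      then show ?thesis
        using subspace_0[OF S] by simp
    next
      case (snoc pre' p)
      have "zigzag True (pre' @ p # e # b # (a + c - e) # ys) u \<in> S"
      proof (rule less.hyps)
        show "length pre' < length pre" "e < b" by (simp_all add: snoc True)
        show "sorted_wrt (\<ge>) (pre' @ [p])" "e \<le> p"
          using less.prems(1,2) True by (auto simp: snoc sorted_wrt_append)
        show "rise True (pre' @ p # e # b # (a + c - e) # ys) = 0"
          using rise[of e] True less.prems(2) by (simp add: snoc)
        fix ms assume ms: "length ms = length (pre' @ p # e # b # (a + c - e) # ys)"
          "sum_list ms = sum_list (pre' @ p # e # b # (a + c - e) # ys)" "rise True ms = 0"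
          "lex_larger (length pre') ms (pre' @ p # e # b # (a + c - e) # ys)"
        then obtain i where i: "i \<le> length pre'" "take i ms = take i (pre' @ p # e # b # (a + c - e) # ys)"
          "(pre' @ p # e # b # (a + c - e) # ys) ! i < ms ! i"
          by (auto simp: lex_larger_def)
        then have "lex_larger (length pre) ms (pre @ a # b # c # ys)"
          unfolding lex_larger_def snoc by (intro exI[of _ i]) (auto simp: nth_append nth_Cons')
        then show "zigzag True ms u \<in> S"
          using less.prems(2,5) ms(1-3) True by (auto simp: snoc)
      qed
      then show ?thesis by (simp add: snoc)
    qed
  qed
  moreover obtain k where "\<forall>v. zigzag True (pre @ a # b # c # ys) v =
    (\<Sum>e\<in>{..<b} \<union> {a + c - b..a + c}. k e *s zigzag True (pre @ e # b # (a + c - e) # ys) v)"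
    using zigzag_exchange[OF less.prems(2,3)] by blast
  ultimately show ?case
    by (simp only:) (intro subspace_sum[OF S] subspace_scale[OF S])
qed

text \<open>
  In a decreasing word the rise is a sum of terms that are not positive, so it is zero only if the
  exponents agree in pairs. Then the word is a product of operators \<open>L\<^sup>i R\<^sup>i\<close>.
\<close>

lemma bottom_zigzag_decreasing:
  assumes "\<And>i v. v \<in> S \<Longrightarrow> (L ^^ i) ((R ^^ i) v) \<in> S" "u \<in> S"
    and "sorted_wrt (\<ge>) ls" "rise True ls = 0"
  shows "zigzag True ls u \<in> S"
  using assms(3,4)
proof (induction ls rule: induct_list012)
  case (3 a b ls)
  then have "a = b" "rise True ls = 0"
    using rise_decreasing[of ls] by auto
  then show ?case
    using 3 assms(1) by auto
qed (use assms(2) in auto)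

text \<open>
  Exchanges at the first ascent make the list of exponents lexicographically larger while its length
  and sum stay fixed, so they end in decreasing words. In a word with an ascent in the first
  position, \<open>L\<^sup>b R\<^sup>c\<close> with \<open>b < c\<close> is applied to a vector of weight below \<open>-d\<close>.
\<close>

lemma bottom_zigzag:
  assumes S: "subspace S" "S \<subseteq> wt (- int d)" "\<And>i v. v \<in> S \<Longrightarrow> (L ^^ i) ((R ^^ i) v) \<in> S"
    and u: "u \<in> S" and "rise True ls = 0"
  shows "zigzag True ls u \<in> S"
proof -
  define r where "r = {(x::nat, y). y < x \<and> x \<le> sum_list ls}"
  have "wf r"
    by (rule wf_subset[OF wf_measure[of "\<lambda>x. Suc (sum_list ls) - x"]]) (auto simp: r_def)
  then have "wf (lexn r (length ls))"
    by (rule wf_lexn)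
  then have "length ms = length ls \<longrightarrow> sum_list ms = sum_list ls \<longrightarrow> rise True ms = 0 \<longrightarrow> zigzag True ms u \<in> S" for ms
  proof (induction ms)
    case (less ms)
    show ?case
    proof (intro impI)
      assume ms: "length ms = length ls" "sum_list ms = sum_list ls" "rise True ms = 0"
      show "zigzag True ms u \<in> S"
      proof (cases "sorted_wrt (\<ge>) ms")
        case True
        then show ?thesis
          using bottom_zigzag_decreasing[OF S(3) u] ms by blast
      next
        case False
        then obtain xs b c ys where split: "ms = xs @ b # c # ys" "sorted_wrt (\<ge>) (xs @ [b])" "b < c"
          using first_ascent by blast
        show ?thesis
        proof (cases xs rule: rev_cases)
          case Nil
          have "zigzag True ys u = 0"
            by (rule wt_trivial_outside[OF zigzag_wt[of u "- int d"]])
              (use ms(3) split Nil S(2) u in auto)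
          then show ?thesis
            using endo_zero[OF endo_funpow[OF endo_gens(1)]] endo_zero[OF endo_funpow[OF endo_gens(2)]]
              subspace_0[OF S(1)] split(1) Nil by simp
        next
          case (snoc pre a)
          have ms_eq: "ms = pre @ a # b # c # ys"
            by (simp add: split(1) snoc)
          show ?thesis
            unfolding ms_eq
          proof (rule bottom_zigzag_ascent[OF S(1)])
            show "u \<in> wt (- int d)" using S(2) u by blast
            show "sorted_wrt (\<ge>) (pre @ [a])" "b \<le> a"
              using split(2) by (auto simp: snoc sorted_wrt_append)
            show "b < c" by fact
            show "rise True (pre @ a # b # c # ys) = 0"
              using ms(3) ms_eq by simp
            fix ms' assume ms': "length ms' = length (pre @ a # b # c # ys)"
              "sum_list ms' = sum_list (pre @ a # b # c # ys)" "rise True ms' = 0"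
              "lex_larger (length pre) ms' (pre @ a # b # c # ys)"
            then have eqs: "length ms' = length ms" "sum_list ms' = sum_list ms" "lex_larger (length pre) ms' ms"
              using ms_eq by auto
            then obtain i where i: "i < length ms" "take i ms' = take i ms" "ms ! i < ms' ! i"
              by (auto simp: lex_larger_def)
            have "ms' ! i \<le> sum_list ms'"
              using i(1) eqs(1) by (intro member_le_sum_list) auto
            then have "(ms' ! i, ms ! i) \<in> r"
              using i(3) eqs(2) ms(2) by (simp add: r_def)
            moreover have "ms' = take i ms @ ms' ! i # drop (Suc i) ms'" "ms = take i ms @ ms ! i # drop (Suc i) ms"
              using i eqs(1) id_take_nth_drop[of i ms'] id_take_nth_drop[of i ms] by auto
            ultimately have "\<exists>xs x y ys zs. ms' = xs @ x # ys \<and> ms = xs @ y # zs \<and> (x, y) \<in> r"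
              by blast
            then have "(ms', ms) \<in> lexn r (length ls)"
              using eqs(1) ms(1) by (auto simp: lexn_conv)
            then show "zigzag True ms' u \<in> S"
              using less eqs ms ms'(3) by simp
          qed
        qed
      qed
    qed
  qed
  then show ?thesis using assms(5) by blast
qed

text \<open>
  The Borel submodule generated by \<open>S\<close> is the span of the zigzag words applied to \<open>S\<close>. Those of rise
  zero stay in \<open>S\<close>, and the others have no component in the lowest weight space. As this submodule is
  everything, its lowest weight space \<open>S\<close> is the whole one.
\<close>

lemma bottom_irreducible:
  assumes S: "subspace S" "S \<subseteq> wt (- int d)" "\<And>i v. v \<in> S \<Longrightarrow> (L ^^ i) ((R ^^ i) v) \<in> S"
    and "S \<noteq> {0}"
  shows "S = wt (- int d)"
proof -
  define G where "G = {zigzag True ls v | ls v. v \<in> S}"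
  define W where "W = span G"
  have stable: "f ` W \<subseteq> W" if "endo f" "\<And>g. g \<in> G \<Longrightarrow> f g \<in> W" for f
    using span_stable that unfolding W_def by blast
  have G_W: "g \<in> W" if "g \<in> G" for g
    using that by (simp add: W_def span_base)
  have "R ` W \<subseteq> W"
  proof (rule stable[OF endo_gens(1)])
    fix g assume "g \<in> G"
    then obtain ls v where "g = zigzag True ls v" "v \<in> S" by (auto simp: G_def)
    then have "R g = zigzag True (0 # 1 # ls) v" "v \<in> S" by simp_all
    then show "R g \<in> W" by (intro G_W) (unfold G_def, blast)
  qed
  moreover have "L ` W \<subseteq> W"
  proof (rule stable[OF endo_gens(2)])
    fix g assume "g \<in> G"
    then obtain ls v where "g = zigzag True ls v" "v \<in> S" by (auto simp: G_def)
    then have "L g = zigzag True (1 # 0 # ls) v" "v \<in> S" by simp_all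
    then show "L g \<in> W" by (intro G_W) (unfold G_def, blast)
  qed
  moreover have "T ` W \<subseteq> W"
  proof (rule stable[OF endo_gens(5)])
    fix g assume g: "g \<in> G"
    then obtain ls v where "g = zigzag True ls v" "v \<in> S" by (auto simp: G_def)
    then have "T g = q powi (- int d + 2 * rise True ls) *s g"
      using S(2) zigzag_wt T_wt by blast
    then show "T g \<in> W"
      using G_W[OF g] by (simp add: W_def span_scale)
  qed
  moreover have "subspace W" by (simp add: W_def)
  moreover have "S \<subseteq> W"
  proof
    fix v assume "v \<in> S"
    then have "zigzag True [] v \<in> G" unfolding G_def by blast
    then show "v \<in> W" using G_W by simp
  qed
  ultimately have W: "W = UNIV"
    using borel_irreducible[of W] assms(4) subspace_0[OF S(1)] by blast
  have "proj 0 w \<in> S" if "w \<in> span G" for w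
    using that
  proof (induction rule: span_induct_alt)
    case base
    then show ?case using subspace_0[OF S(1)] by (simp add: endo_zero[OF endo_proj])
  next
    case (step c x y)
    obtain ls v where x: "x = zigzag True ls v" "v \<in> S"
      using step(1) by (auto simp: G_def)
    have "x \<in> wt (- int d + 2 * rise True ls)"
      using x S(2) zigzag_wt by blast
    then have "proj 0 x = (if rise True ls = 0 then x else 0)"
      by (simp add: proj_wt)
    also have "\<dots> \<in> S"
      using bottom_zigzag[OF S x(2)] subspace_0[OF S(1)] x(1) by simp
    finally show ?case
      using step S(1) by (simp add: endo_add[OF endo_proj] endo_scale[OF endo_proj] subspace_add subspace_scale)
  qed
  then have "v \<in> S" if "v \<in> wt (- int d)" for v
    using W proj_wt[OF that, of 0] by (metis UNIV_I W_def diff_0 le0 mult_zero_right of_nat_0)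
  then show ?thesis
    using S(2) by blast
qed

end

text \<open>
  With a constant map in the middle, \<open>sandwich\<close> evaluates the polynomial at \<open>f\<close> and applies the result to
  \<open>v\<close>. Splitting off a root \<open>c\<close> replaces \<open>v\<close> by \<open>f v - c v\<close>, unless \<open>v\<close> is an eigenvector already.
\<close>

lemma (in q_vector_space) annihilating_polynomial_eigenvector:
  fixes f :: "'v \<Rightarrow> 'v" and p :: "'k poly"
  assumes closed: "\<And>p::'k poly. degree p > 0 \<Longrightarrow> \<exists>z. poly p z = 0"
    and f: "endo f" "subspace S" "f ` S \<subseteq> S"
    and "v \<in> S" "v \<noteq> 0" "p \<noteq> 0" "degree p \<le> m" "sandwich f m p (\<lambda>_. v) 0 = 0"
  shows "\<exists>c. \<exists>u\<in>S. u \<noteq> 0 \<and> f u = c *s u"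
  using assms(5-)
proof (induction m arbitrary: v p)
  case 0
  then have "coeff p 0 \<noteq> 0"
    by (metis le_zero_eq leading_coeff_0_iff)
  then show ?case
    using 0 by (simp add: sandwich_def)
next
  case (Suc m)
  show ?case
  proof (cases "degree p = 0")
    case True
    then obtain a where a: "p = [:a:]" by (auto elim: degree_eq_zeroE)
    have "sandwich f (Suc m) p (\<lambda>_. v) 0 = a *s v"
      unfolding sandwich_def a by (subst sum.atMost_Suc_shift) simp
    then show ?thesis
      using Suc.prems a by simp
  next
    case False
    then obtain c where "poly p c = 0" using closed by auto
    then obtain r where r: "p = [:- c, 1:] * r"
      by (auto simp: poly_eq_0_iff_dvd elim: dvdE)
    have r0: "r \<noteq> 0" using r Suc.prems by auto
    then have "degree p = Suc (degree r)"
      unfolding r by (subst degree_mult_eq) auto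
    then have "degree r \<le> m" using Suc.prems by simp
    show ?thesis
    proof (cases "f v = c *s v")
      case True
      then show ?thesis using Suc.prems by blast
    next
      case False
      have "twist f c (\<lambda>_. v) = (\<lambda>_. f v - c *s v)"
        by (simp add: fun_eq_iff twist_def)
      then have "sandwich f m r (\<lambda>_. f v - c *s v) 0 = 0"
        using sandwich_twist[OF f(1) \<open>degree r \<le> m\<close>, of c "\<lambda>_. v" 0] Suc.prems(5) r by simp
      moreover have "f v - c *s v \<in> S"
        using f Suc.prems(1) by (intro subspace_diff subspace_scale) auto
      ultimately show ?thesis
        using Suc.IH[of "f v - c *s v" r] False r0 \<open>degree r \<le> m\<close> by simp
    qed
  qed
qed

context q_vector_space
begin

text \<open>
  In a space spanned by \<open>m\<close> vectors the \<open>m + 1\<close> iterates \<open>v, f v, \<dots>, f\<^sup>m v\<close> are linearly dependent.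
\<close>

lemma annihilating_polynomial:
  assumes "finite B" "span B = UNIV"
  shows "\<exists>p. p \<noteq> 0 \<and> degree p \<le> card B \<and> sandwich f (card B) p (\<lambda>_. v) 0 = 0"
proof -
  define m where "m = card B"
  define g where "g i = (f ^^ i) v" for i
  show ?thesis
    unfolding m_def[symmetric]
  proof (cases "inj_on g {..m}")
    case False
    then obtain i j where ij: "i \<le> m" "j \<le> m" "i \<noteq> j" "g i = g j"
      by (auto simp: inj_on_def)
    have "coeff (monom 1 i - monom 1 j) i = (1 :: 'k)"
      using ij(3) by simp
    then have "monom 1 i - monom 1 j \<noteq> (0 :: 'k poly)"
      by force
    moreover have "degree (monom 1 i - monom (1::'k) j) \<le> m"
      using ij by (intro degree_diff_le order_trans[OF degree_monom_le])
    moreover have "sandwich f m (monom 1 i - monom 1 j) (\<lambda>_. v) 0 = 0"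
      using ij by (simp add: sandwich_diff sandwich_monom g_def)
    ultimately show "\<exists>p. p \<noteq> 0 \<and> degree p \<le> m \<and> sandwich f m p (\<lambda>_. v) 0 = 0" by blast
  next
    case True
    then have "card (g ` {..m}) = Suc m"
      by (simp add: card_image)
    then have "dependent (g ` {..m})"
      using independent_span_bound[OF assms(1), of "g ` {..m}"] assms(2) by (auto simp: m_def)
    then obtain u where u: "\<exists>w\<in>g ` {..m}. u w \<noteq> 0" "(\<Sum>w\<in>g ` {..m}. u w *s w) = 0"
      by (auto simp: dependent_finite)
    define p where "p = (\<Sum>i\<le>m. monom (u (g i)) i)"
    have coeff: "coeff p i = u (g i)" if "i \<le> m" for i
      using that by (simp add: p_def coeff_sum)
    have "p \<noteq> 0"
      using u(1) coeff by force
    moreover have "degree p \<le> m"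
      unfolding p_def by (intro degree_sum_le order_trans[OF degree_monom_le]) auto
    moreover have "sandwich f m p (\<lambda>_. v) 0 = (\<Sum>i\<le>m. u (g i) *s g i)"
      unfolding sandwich_def by (rule sum.cong) (auto simp: coeff g_def)
    ultimately show "\<exists>p. p \<noteq> 0 \<and> degree p \<le> m \<and> sandwich f m p (\<lambda>_. v) 0 = 0"
      using u(2) by (auto simp: sum.reindex[OF True])
  qed
qed

lemma twist_commute: "endo A \<Longrightarrow> twist A c (twist A e B) = twist A e (twist A c B)"
  by (simp add: fun_eq_iff twist_def endo_simps algebra_simps)

lemma q_powi_two_cancel: "q powi 2 * q powi (- 2) = 1" "q powi (- 2) * q powi 2 = 1"
  using power_int_add[of q 2 "- 2"] power_int_add[of q "- 2" 2] q_nonzero by auto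

lemma serre_iff: "serre A B \<longleftrightarrow> (\<forall>v. twist A (q powi (- 2)) (twist A 1 (twist A (q powi 2) B)) v = 0)"
  by (simp add: numeral_3_eq_3 del: power_int_minus)

text \<open>
  Here \<open>[3] = q\<^sup>2 + 1 + q\<^sup>-\<^sup>2\<close>.
\<close>

lemma serre_expand:
  assumes "endo A"
  shows "twist A (q powi (- 2)) (twist A 1 (twist A (q powi 2) B)) v =
    A (A (A (B v))) - q_int q 3 *s A (A (B (A v))) + q_int q 3 *s A (B (A (A v))) - B (A (A (A v)))"
proof -
  define s t where "s = q powi 2" and "t = q powi (- 2)"
  have st: "s * t = 1"
    unfolding s_def t_def by (rule q_powi_two_cancel)
  have "q_int q 3 = s + 1 + t"
  proof -
    have "(s + 1 + t) * (q - inverse q) = q ^ 3 - inverse q ^ 3"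
      using q_nonzero by (simp add: s_def t_def power_int_minus field_simps power2_eq_square power3_eq_cube)
    then show ?thesis
      using q_minus_inverse by (simp add: q_int_def field_simps)
  qed
  moreover have "twist A t (twist A 1 (twist A s B)) v =
    A (A (A (B v))) - (s + 1 + t) *s A (A (B (A v))) + (s + s * t + t) *s A (B (A (A v))) - (s * t) *s B (A (A (A v)))"
    using assms by (simp add: twist_def endo_simps algebra_simps)
  ultimately show ?thesis
    unfolding s_def[symmetric] t_def[symmetric] st by simp
qed

end

context weight_module
begin

text \<open>
  An eigenspace of \<open>L\<^sup>i R\<^sup>i\<close> on the lowest weight space is stable under all \<open>L\<^sup>j R\<^sup>j\<close>, because these
  operators commute.
\<close>

lemma bottom_scalar:
  assumes closed: "\<And>p::'k poly. degree p > 0 \<Longrightarrow> \<exists>z. poly p z = 0"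
  shows "\<exists>c. \<forall>u\<in>wt (- int d). (L ^^ i) ((R ^^ i) u) = c *s u"
proof -
  define f where "f u = (L ^^ i) ((R ^^ i) u)" for u
  have f: "endo f"
    unfolding f_def using endo_funpow endo_gens endo_comp by blast
  have f_wt: "f ` wt (- int d) \<subseteq> wt (- int d)"
    using L_pow_wt[OF R_pow_wt, of _ "- int d" i i] by (auto simp: f_def)
  obtain v where v: "v \<in> wt (- int d)" "v \<noteq> 0"
    using weight_nonzero[of 0] subspace_0[OF subspace_wt] by auto
  obtain B where B: "finite B" "span B = UNIV"
    using finite_dim by blast
  obtain p where p: "p \<noteq> 0" "degree p \<le> card B" "sandwich f (card B) p (\<lambda>_. v) 0 = 0"
    using annihilating_polynomial[OF B] by blast
  obtain c u where u: "u \<in> wt (- int d)" "u \<noteq> 0" "f u = c *s u"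
    using annihilating_polynomial_eigenvector[OF closed f subspace_wt f_wt v p] by blast
  define S where "S = {u \<in> wt (- int d). f u = c *s u}"
  have "S = wt (- int d)"
  proof (rule bottom_irreducible)
    show "subspace S"
      using subspace_wt[of "- int d"] f
      by (auto simp: S_def subspace_def endo_simps scale_right_distrib mult.commute)
    show "(L ^^ j) ((R ^^ j) w) \<in> S" if "w \<in> S" for j w
    proof -
      have w: "w \<in> wt (- int d)" "f w = c *s w"
        using that by (auto simp: S_def)
      have "(L ^^ j) ((R ^^ j) w) \<in> wt (- int d)"
        using L_pow_wt[OF R_pow_wt[OF w(1), of j], of j] by simp
      moreover have "f ((L ^^ j) ((R ^^ j) w)) = (L ^^ j) ((R ^^ j) (f w))"
        unfolding f_def using bottom_operators_commute[OF w(1)] .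
      ultimately show ?thesis
        using w(2) endo_scale[OF endo_funpow[OF endo_gens(1)]] endo_scale[OF endo_funpow[OF endo_gens(2)]]
        by (simp add: S_def)
    qed
  qed (use u in \<open>auto simp: S_def\<close>)
  then show ?thesis
    by (auto simp: S_def f_def)
qed

end

section \<open>The operators \<open>x = R + T\<close> and \<open>y = L + T'\<close>\<close>

context weight_module
begin

definition x_op :: "'v \<Rightarrow> 'v" where "x_op v = R v + T v"
definition y_op :: "'v \<Rightarrow> 'v" where "y_op v = L v + T' v"

lemma endo_x: "endo x_op" and endo_y: "endo y_op"
  using endo_gens by (simp_all add: endo_iff x_op_def y_op_def algebra_simps)

lemma T'_R: "T' (R v) = q powi (- 2) *s R (T' v)"
proof -
  interpret sw: weight_module scale q d L R Lm Rm T' T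
    by (rule swap)
  show ?thesis by (rule sw.T_L)
qed

text \<open>
  Twisted commutators with \<open>x\<close> can be taken in any order. On \<open>T'\<close> the factor \<open>q\<^sup>2\<close> leaves a scalar, which
  the factor \<open>1\<close> kills. On \<open>L\<close>, taking the factors in the order \<open>q\<^sup>-\<^sup>2, 1, q\<^sup>2\<close>, the part \<open>T\<close> of \<open>x\<close>
  never contributes, because each intermediate result commutes with \<open>T\<close> up to exactly the factor
  that comes next. So on \<open>L\<close> the operator \<open>x\<close> may be replaced by \<open>R\<close>.
\<close>

lemma serre_x_y: "serre x_op y_op"
proof -
  let ?a = "q powi (- 2)" and ?b = "q powi 2"
  note ab = q_powi_two_cancel
  have "twist x_op ?b T' = (\<lambda>v. (1 - ?b) *s v)"
    using endo_gens ab by (simp add: fun_eq_iff twist_def x_op_def T'_R T_inverse endo_simps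
        scale_left_diff_distrib scale_right_distrib)
  then have "twist x_op 1 (twist x_op ?b T') = (\<lambda>v. 0)"
    by (simp add: fun_eq_iff twist_def endo_scale[OF endo_x])
  then have 1: "twist x_op ?a (twist x_op 1 (twist x_op ?b T')) v = 0" for v
    by (simp add: twist_def endo_zero[OF endo_x])
  define D1 where "D1 = twist R ?a L"
  define D2 where "D2 = twist R 1 D1"
  have D1: "twist x_op ?a L = D1"
    by (simp add: fun_eq_iff D1_def twist_def x_op_def T_L endo_simps[OF endo_gens(2)] algebra_simps)
  have TD1: "T (D1 v) = D1 (T v)" for v
    using endo_gens ab by (simp add: D1_def twist_def endo_simps T_L T_R mult.assoc)
  have endo_D1: "endo D1"
    unfolding D1_def using endo_gens endo_twist by blast
  have D2: "twist x_op 1 D1 = D2"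
    by (simp add: fun_eq_iff D2_def twist_def x_op_def TD1 endo_simps[OF endo_D1] algebra_simps)
  have TD2: "T (D2 v) = ?b *s D2 (T v)" for v
    using endo_gens(5) by (simp add: D2_def twist_def endo_simps endo_simps[OF endo_D1] TD1 T_R algebra_simps)
  have endo_D2: "endo D2"
    unfolding D2_def using endo_gens endo_D1 endo_twist by blast
  have "twist x_op ?b D2 = twist R ?b D2"
    by (simp add: fun_eq_iff twist_def x_op_def TD2 endo_simps[OF endo_D2] algebra_simps)
  also have "\<dots> = twist R ?a (twist R 1 (twist R ?b L))"
    unfolding D2_def D1_def by (metis twist_commute[OF endo_gens(1)])
  finally have "twist x_op ?b D2 v = 0" for v
    using serre_RL unfolding serre_iff by simp
  then have "twist x_op ?b (twist x_op 1 (twist x_op ?a L)) v = 0" for v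
    by (simp add: D1 D2)
  then have 2: "twist x_op ?a (twist x_op 1 (twist x_op ?b L)) v = 0" for v
    by (metis twist_commute[OF endo_x])
  have add: "twist x_op c (\<lambda>v. f v + g v) = (\<lambda>v. twist x_op c f v + twist x_op c g v)" for c f g
    by (simp add: fun_eq_iff twist_def endo_simps[OF endo_x] algebra_simps)
  have "y_op = (\<lambda>v. L v + T' v)"
    by (simp add: fun_eq_iff y_op_def)
  then show ?thesis
    unfolding serre_iff by (simp only: add 1 2) simp
qed

lemma serre_y_x: "serre y_op x_op"
proof -
  interpret sw: weight_module scale q d L R Lm Rm T' T
    by (rule swap)
  have "sw.x_op = y_op" "sw.y_op = x_op"
    by (simp_all add: fun_eq_iff sw.x_op_def sw.y_op_def x_op_def y_op_def)
  then show ?thesis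
    using sw.serre_x_y by simp
qed

lemma proj_shift:
  assumes "endo f" "\<And>n v. v \<in> wt n \<Longrightarrow> f v \<in> wt (n + 2 * s)" "i \<le> d"
  shows "proj i (f v) = (if 0 \<le> int i - s \<and> int i - s \<le> int d then f (proj (nat (int i - s)) v) else 0)"
proof -
  have "proj i (f v) = (\<Sum>k\<le>d. proj i (f (proj k v)))"
    using endo_sum[OF endo_comp[OF endo_proj assms(1)], of i "\<lambda>k. proj k v" "{..d}"]
    by (simp add: sum_proj)
  also have "\<dots> = (\<Sum>k\<le>d. if int k = int i - s then f (proj k v) else 0)"
    by (rule sum.cong) (use proj_wt[OF assms(2)[OF proj_in_wt] assms(3)] in auto)
  also have "\<dots> = (if 0 \<le> int i - s \<and> int i - s \<le> int d then f (proj (nat (int i - s)) v) else 0)"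
  proof (cases "0 \<le> int i - s \<and> int i - s \<le> int d")
    case True
    then have "(\<Sum>k\<le>d. if int k = int i - s then f (proj k v) else 0) =
        (\<Sum>k\<le>d. if k = nat (int i - s) then f (proj k v) else 0)"
      by (intro sum.cong) auto
    then show ?thesis using True by auto
  next
    case False
    then show ?thesis by (auto intro!: sum.neutral)
  qed
  finally show ?thesis .
qed

lemma proj_above: "d < i \<Longrightarrow> proj i v = 0"
proof -
  assume "d < i"
  then have "proj i (\<Sum>k\<le>d. proj k v) = 0"
    unfolding endo_sum[OF endo_proj] using proj_weight[OF proj_in_wt] by (intro sum.neutral) auto
  then show ?thesis by (simp add: sum_proj)
qed

lemma proj_R: "Suc i \<le> d \<Longrightarrow> proj (Suc i) (R v) = R (proj i v)" "proj 0 (R v) = 0"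
  using proj_shift[OF endo_gens(1), of 1] R_wt by simp_all

lemma proj_L: "i \<le> d \<Longrightarrow> proj i (L v) = L (proj (Suc i) v)"
proof -
  assume i: "i \<le> d"
  have "nat (int i + 1) = Suc i" by simp
  then show ?thesis
    using proj_shift[OF endo_gens(2), of "- 1" i v] L_wt i proj_above[of "Suc i" v]
    by (auto simp: endo_zero[OF endo_gens(2)])
qed

lemma proj_T: "i \<le> d \<Longrightarrow> proj i (T v) = q powi (2 * int i - int d) *s proj i v"
  using endo_gens T_wt[OF proj_in_wt, of i v]
  by (simp add: proj_def Let_def endo_simps shift_prod_commute del: upt_Suc)

lemma proj_T': "i \<le> d \<Longrightarrow> proj i (T' v) = q powi (int d - 2 * int i) *s proj i v"
proof -
  assume i: "i \<le> d"
  have "v \<in> wt n \<Longrightarrow> T' v \<in> wt (n + 2 * 0)" for v n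
    using T'_wt[of v n] subspace_scale[OF subspace_wt] by simp
  then have "proj i (T' v) = T' (proj i v)"
    using proj_shift[OF endo_gens(6), of 0 i v] i by simp
  then show ?thesis
    using T'_wt[OF proj_in_wt[OF i], of v] by simp
qed

definition word :: "bool list \<Rightarrow> 'v \<Rightarrow> 'v" where
  "word = foldr (\<lambda>t. if t then L else R)"

lemma word_simps [simp]:
  "word [] v = v" "word (t # ts) v = (if t then L else R) (word ts v)"
  "word (ts @ [t]) v = word ts ((if t then L else R) v)"
  by (simp_all add: word_def)

lemma endo_word: "endo (word ts)"
  using endo_gens by (induction ts) (auto simp: endo_iff)

lemma word_T: "\<exists>c. \<forall>v. word ts (T v) = c *s T (word ts v)"
proof (induction ts)
  case (Cons t ts)
  then obtain c where c: "\<And>v. word ts (T v) = c *s T (word ts v)" by blast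
  note * = q_powi_two_cancel
  have "L (T v) = q powi 2 *s T (L v)" "R (T v) = q powi (- 2) *s T (R v)" for v
    by (simp_all only: T_L T_R scale_scale * scale_one)
  then have "word (t # ts) (T v) = (c * (if t then q powi 2 else q powi (- 2))) *s T (word (t # ts) v)" for v
    using endo_gens by (simp add: c endo_simps del: power_int_minus)
  then show ?case by blast
qed (auto intro: exI[of _ 1])

text \<open>
  Suppose that the lowest component vanishes on \<open>W\<close>. In a word in \<open>R\<close> and \<open>L\<close> the letter applied first may
  be replaced by \<open>x\<close> or \<open>y\<close> at the cost of a term with \<open>T\<close> or \<open>T'\<close> in its place, and these can be
  moved to the left, where they act as scalars. So the lowest component of every word vanishes on \<open>W\<close>. The vectors
  with this property form a Borel submodule, which contains \<open>W\<close> but not the lowest weight space.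
\<close>

lemma stable_meets_bottom:
  assumes W: "subspace W" "x_op ` W \<subseteq> W" "y_op ` W \<subseteq> W" "W \<noteq> {0}"
  shows "\<exists>w\<in>W. proj 0 w \<noteq> 0"
proof (rule ccontr)
  assume "\<not> ?thesis"
  then have W0: "proj 0 w = 0" if "w \<in> W" for w using that by blast
  define Z where "Z = {v. \<forall>ts. proj 0 (word ts v) = 0}"
  have T: "proj 0 (word ts (T v)) = 0" if "proj 0 (word ts v) = 0" for ts v
  proof -
    obtain c where "word ts (T v) = c *s T (word ts v)"
      using word_T by blast
    then show ?thesis
      using that proj_T[of 0] endo_scale[OF endo_proj] by simp
  qed
  have T': "proj 0 (word ts (T' v)) = 0" if "proj 0 (word ts v) = 0" for ts v
  proof -
    obtain c where c: "\<And>v. word ts (T v) = c *s T (word ts v)"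
      using word_T by blast
    have "word ts v = c *s T (word ts (T' v))"
      using c[of "T' v"] by (simp add: T_inverse)
    then have "c *s proj 0 (word ts (T' v)) = 0"
      using that proj_T[of 0 "word ts (T' v)"] endo_scale[OF endo_proj] q_nonzero by auto
    moreover have "word ts (T' v) = 0" if "c = 0"
      using c[of "T' (T' v)"] that by (simp add: T_inverse)
    ultimately show ?thesis
      using endo_zero[OF endo_proj] by auto
  qed
  have "w \<in> Z" if "w \<in> W" for w
  proof -
    have "\<forall>w\<in>W. proj 0 (word ts w) = 0" for ts
    proof (induction ts rule: rev_induct)
      case Nil
      then show ?case using W0 by simp
    next
      case (snoc t ts)
      show ?case
      proof
        fix w assume w: "w \<in> W"
        have "R w = x_op w - T w" "L w = y_op w - T' w"
          by (simp_all add: x_op_def y_op_def)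
        then have "word (ts @ [t]) w = (if t then word ts (y_op w) - word ts (T' w) else word ts (x_op w) - word ts (T w))"
          by (simp add: endo_diff[OF endo_word])
        then show "proj 0 (word (ts @ [t]) w) = 0"
          using snoc w W(2,3) T T' by (auto simp: endo_diff[OF endo_proj])
      qed
    qed
    then show ?thesis using that by (simp add: Z_def)
  qed
  then have "Z \<noteq> {0}"
    using W(1,4) subspace_0 by blast
  moreover have "subspace Z"
    by (auto simp: Z_def subspace_def endo_simps[OF endo_word] endo_simps[OF endo_proj])
  moreover have "R ` Z \<subseteq> Z" "L ` Z \<subseteq> Z"
  proof -
    have "proj 0 (word ts (R v)) = 0 \<and> proj 0 (word ts (L v)) = 0" if "v \<in> Z" for v ts
    proof -
      have "proj 0 (word (ts @ [False]) v) = 0" "proj 0 (word (ts @ [True]) v) = 0"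
        using that unfolding Z_def by blast+
      then show ?thesis by simp
    qed
    then show "R ` Z \<subseteq> Z" "L ` Z \<subseteq> Z"
      by (auto simp: Z_def)
  qed
  moreover have "T ` Z \<subseteq> Z"
    using T by (auto simp: Z_def)
  ultimately have Z: "Z = UNIV"
    using borel_irreducible[of Z] by blast
  obtain v where "v \<in> wt (- int d)" "v \<noteq> 0"
    using weight_nonzero[of 0] subspace_0[OF subspace_wt] by auto
  then have "proj 0 (word [] v) \<noteq> 0"
    using proj_weight[of v 0 0] by simp
  then show False
    using Z unfolding Z_def by blast
qed

text \<open>
  On a weight vector \<open>R\<close> differs from \<open>x\<close>, and \<open>L\<close> from \<open>y\<close>, by a scalar. So \<open>W\<close> contains all words in
  \<open>R\<close> and \<open>L\<close> applied to \<open>u\<close>, and these span a Borel submodule.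
\<close>

lemma bottom_generates:
  assumes W: "subspace W" "x_op ` W \<subseteq> W" "y_op ` W \<subseteq> W"
    and u: "u \<in> W" "u \<in> wt (- int d)" "u \<noteq> 0"
  shows "W = UNIV"
proof -
  define G where "G = range (\<lambda>ts. word ts u)"
  have hom: "\<exists>n. word ts u \<in> wt n" for ts
  proof (induction ts)
    case (Cons t ts)
    then obtain n where n: "word ts u \<in> wt n" by blast
    show ?case
      using R_wt[OF n] L_wt[OF n] by (cases t) auto
  qed (use u(2) in auto)
  have "word ts u \<in> W" for ts
  proof (induction ts)
    case (Cons t ts)
    obtain n where n: "word ts u \<in> wt n" using hom by blast
    have "R (word ts u) = x_op (word ts u) - q powi n *s word ts u"
      "L (word ts u) = y_op (word ts u) - q powi (- n) *s word ts u"
      using T_wt[OF n] T'_wt[OF n] by (simp_all add: x_op_def y_op_def)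
    then show ?case
      using Cons W by (auto intro!: subspace_diff[OF W(1)] subspace_scale[OF W(1)])
  qed (simp add: u)
  then have "span G \<subseteq> W"
    using W(1) by (intro span_minimal) (auto simp: G_def)
  moreover have "span G = UNIV"
  proof -
    have "R ` span G \<subseteq> span G"
      using endo_gens(1)
    proof (rule span_stable)
      fix g assume "g \<in> G"
      then obtain ts where "g = word ts u" by (auto simp: G_def)
      then have "R g = word (False # ts) u" by simp
      then show "R g \<in> span G" unfolding G_def by (metis rangeI span_base)
    qed
    moreover have "L ` span G \<subseteq> span G"
      using endo_gens(2)
    proof (rule span_stable)
      fix g assume "g \<in> G"
      then obtain ts where "g = word ts u" by (auto simp: G_def)
      then have "L g = word (True # ts) u" by simp
      then show "L g \<in> span G" unfolding G_def by (metis rangeI span_base)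
    qed
    moreover have "T ` span G \<subseteq> span G"
      using endo_gens(5)
    proof (rule span_stable)
      fix g assume g: "g \<in> G"
      then obtain n where "g \<in> wt n" using hom by (auto simp: G_def)
      then show "T g \<in> span G" using g by (simp add: T_wt span_base span_scale)
    qed
    moreover have "u \<in> span G"
    proof -
      have "word [] u \<in> G" unfolding G_def by blast
      then show ?thesis using span_base by simp
    qed
    ultimately show ?thesis
      using borel_irreducible[of "span G"] u(3) by auto
  qed
  ultimately show ?thesis by blast
qed

end

lemma prod_list_map_nonzero:
  fixes f :: "'a \<Rightarrow> 'b::idom"
  assumes "\<And>e. e \<in> set es \<Longrightarrow> f e \<noteq> 0"
  shows "prod_list (map f es) \<noteq> 0"
  using assms by (induction es) auto

context weight_module
begin

abbreviation theta :: "nat \<Rightarrow> 'k" where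
  "theta i \<equiv> q powi (2 * int i - int d)"

lemma theta_eq_iff: "theta i = theta j \<longleftrightarrow> i = j"
  by (simp add: q_powi_eq_iff)

text \<open>
  The sum of the weight spaces from the \<open>i\<close>-th on. The operator \<open>x\<close> preserves this filtration and acts on
  the \<open>i\<close>-th quotient as the scalar \<open>theta i\<close>.
\<close>

definition up :: "nat \<Rightarrow> 'v set" where
  "up i = {v. \<forall>j<i. proj j v = 0}"

lemma up_0 [simp]: "v \<in> up 0"
  by (simp add: up_def)

lemma up_top: "v \<in> up (Suc d) \<Longrightarrow> v = 0"
proof -
  assume "v \<in> up (Suc d)"
  then have "(\<Sum>i\<le>d. proj i v) = 0"
    by (intro sum.neutral) (auto simp: up_def)
  then show ?thesis by (simp add: sum_proj)
qed

lemma wt_up: "v \<in> wt (2 * int i - int d) \<Longrightarrow> i \<le> d \<Longrightarrow> v \<in> up i"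
  using proj_weight by (simp add: up_def)

lemma proj_x: "Suc i \<le> d \<Longrightarrow> proj (Suc i) (x_op v) = R (proj i v) + theta (Suc i) *s proj (Suc i) v"
  "proj 0 (x_op v) = theta 0 *s proj 0 v"
  by (simp_all add: x_op_def endo_add[OF endo_proj] proj_R proj_T del: power_int_minus)

lemma proj_y: "i \<le> d \<Longrightarrow> proj i (y_op v) = L (proj (Suc i) v) + q powi (int d - 2 * int i) *s proj i v"
  by (simp add: y_op_def endo_add[OF endo_proj] proj_L proj_T')

lemma proj_x_up:
  assumes "v \<in> up i" "j \<le> i"
  shows "proj j (x_op v) = theta j *s proj j v"
proof (cases "j \<le> d")
  case True
  show ?thesis
  proof (cases j)
    case 0
    then show ?thesis using proj_x(2) by simp
  next
    case (Suc k)
    then have "proj k v = 0" using assms by (simp add: up_def)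
    then show ?thesis
      using proj_x(1)[of k v] True Suc endo_zero[OF endo_gens(1)] by simp
  qed
next
  case False
  then show ?thesis by (simp add: proj_above)
qed

lemma x_minus_up:
  assumes "v \<in> up i"
  shows "x_op v - c *s v \<in> up i" "x_op v - theta i *s v \<in> up (Suc i)"
  using proj_x_up[OF assms] assms
  by (auto simp: up_def endo_diff[OF endo_proj] endo_scale[OF endo_proj] less_Suc_eq_le le_less)

lemma shift_prod_x_up:
  assumes "v \<in> up i" "i \<le> k"
  shows "shift_prod x_op (rev (map theta [i..<k])) v \<in> up k"
  using assms(2)
proof (induction k rule: dec_induct)
  case base
  then show ?case using assms by simp
next
  case (step k)
  then show ?case
    using x_minus_up(2) by simp
qed

text \<open>
  An eigenvalue is read off from the lowest nonzero component of an eigenvector. Conversely, applying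
  the remaining factors \<open>x - theta j\<close> with \<open>j > i\<close> to a vector of the \<open>i\<close>-th weight space gives an
  eigenvector; it is not zero because its \<open>i\<close>-th component has only been multiplied by nonzero scalars.
\<close>

lemma x_eigenvalues: "(\<exists>w. w \<noteq> 0 \<and> x_op w = c *s w) \<longleftrightarrow> (\<exists>i\<le>d. c = theta i)"
proof
  assume "\<exists>w. w \<noteq> 0 \<and> x_op w = c *s w"
  then obtain w where w: "w \<noteq> 0" "x_op w = c *s w" by blast
  have "\<exists>j. proj j w \<noteq> 0"
    using w(1) sum_proj[of w] by (metis sum.neutral)
  then obtain j where j: "proj j w \<noteq> 0" "w \<in> up j"
    unfolding up_def using exists_least_iff[of "\<lambda>j. proj j w \<noteq> 0"] by auto
  have "c *s proj j w = theta j *s proj j w"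
    using proj_x_up[OF j(2), of j] w(2) endo_scale[OF endo_proj] by simp
  then have "c = theta j"
    using j(1) by simp
  moreover have "j \<le> d"
    using j(1) proj_above leI by blast
  ultimately show "\<exists>i\<le>d. c = theta i" by blast
next
  assume "\<exists>i\<le>d. c = theta i"
  then obtain i where i: "i \<le> d" "c = theta i" by blast
  obtain v where v: "v \<in> wt (2 * int i - int d)" "v \<noteq> 0"
    using weight_nonzero[OF i(1)] subspace_0[OF subspace_wt] by blast
  define w where "w k = shift_prod x_op (rev (map theta [Suc i..<k])) v" for k
  have v_up: "v \<in> up i" using wt_up[OF v(1) i(1)] .
  have "w k \<in> up i \<and> proj i (w k) \<noteq> 0" if "Suc i \<le> k" for k
    using that
  proof (induction k rule: dec_induct)
    case base
    then show ?case
      using v v_up proj_weight[OF v(1) i(1)] by (simp add: w_def)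
  next
    case (step k)
    then have w: "w (Suc k) = x_op (w k) - theta k *s w k"
      by (simp add: w_def)
    have "proj i (w (Suc k)) = (theta i - theta k) *s proj i (w k)"
      unfolding w using step.IH proj_x_up[of "w k" i i]
      by (simp add: endo_diff[OF endo_proj] endo_scale[OF endo_proj] scale_left_diff_distrib)
    moreover have "theta i - theta k \<noteq> 0"
      using step theta_eq_iff[of i k] by auto
    ultimately show ?case
      using step.IH x_minus_up(1) unfolding w by auto
  qed
  then have "proj i (w (Suc d)) \<noteq> 0"
    using i by simp
  then have "w (Suc d) \<noteq> 0"
    using endo_zero[OF endo_proj] by auto
  moreover have "x_op (w (Suc d)) = c *s w (Suc d)"
  proof -
    have "x_op v - theta i *s v \<in> up (Suc i)"
      using x_minus_up(2)[OF v_up] .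
    then have "shift_prod x_op (rev (map theta [Suc i..<Suc d])) (x_op v - theta i *s v) = 0"
      using shift_prod_x_up up_top i(1) by blast
    then show ?thesis
      unfolding w_def i(2) using shift_prod_commute[OF endo_x]
      by (simp only: endo_diff[OF endo_shift_prod[OF endo_x]] endo_scale[OF endo_shift_prod[OF endo_x]] right_minus_eq)
  qed
  ultimately show "\<exists>w. w \<noteq> 0 \<and> x_op w = c *s w" by blast
qed

lemma y_eigenvalues: "(\<exists>w. w \<noteq> 0 \<and> y_op w = c *s w) \<longleftrightarrow> (\<exists>i\<le>d. c = theta i)"
proof -
  interpret sw: weight_module scale q d L R Lm Rm T' T
    by (rule swap)
  have "y_op = sw.x_op"
    by (simp add: fun_eq_iff y_op_def sw.x_op_def)
  then show ?thesis
    using sw.x_eigenvalues by simp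
qed

text \<open>
  The coefficients of the eigenvector of \<open>x\<close> with given lowest component.
\<close>

definition eigen_coeff :: "nat \<Rightarrow> 'k" where
  "eigen_coeff i = (\<Prod>j=1..i. inverse (theta 0 - theta j))"

text \<open>
  The coefficients of the projection to the lowest weight space along the other eigenspaces
  of \<open>y\<close>. The lowest weight space is the eigenspace of \<open>y\<close> for the eigenvalue \<open>q\<^sup>d\<close>.
\<close>

definition coeigen_coeff :: "nat \<Rightarrow> 'k" where
  "coeigen_coeff i = (\<Prod>j=1..i. inverse (q powi int d - q powi (int d - 2 * int j)))"

definition x_eigenvector :: "'v \<Rightarrow> 'v" where
  "x_eigenvector u = (\<Sum>i\<le>d. eigen_coeff i *s (R ^^ i) u)"

definition y_coeigenvector :: "'v \<Rightarrow> 'v" where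
  "y_coeigenvector v = (\<Sum>i\<le>d. coeigen_coeff i *s (L ^^ i) (proj i v))"

lemma eigen_coeff_Suc: "(theta 0 - theta (Suc i)) * eigen_coeff (Suc i) = eigen_coeff i"
  using theta_eq_iff[of 0 "Suc i"] by (simp add: eigen_coeff_def)

lemma coeigen_coeff_Suc: "(q powi int d - q powi (int d - 2 * int (Suc i))) * coeigen_coeff (Suc i) = coeigen_coeff i"
  using q_powi_eq_iff[of "int d" "int d - 2 * int (Suc i)"] by (simp add: coeigen_coeff_def del: power_int_of_nat)

lemma x_eigenvector:
  assumes u: "u \<in> wt (- int d)"
  shows "x_op (x_eigenvector u) = theta 0 *s x_eigenvector u"
proof -
  let ?v = "\<lambda>i. (R ^^ i) u"
  have T: "T (?v i) = theta i *s ?v i" for i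
    using T_wt[OF R_pow_wt[OF u, of i]] by (simp add: algebra_simps)
  have top: "?v (Suc d) = 0"
    by (rule wt_trivial_outside[OF R_pow_wt[OF u]]) auto
  have "x_op (x_eigenvector u) - theta 0 *s x_eigenvector u =
      (\<Sum>i\<le>d. eigen_coeff i *s ?v (Suc i)) - (\<Sum>i\<le>d. ((theta 0 - theta i) * eigen_coeff i) *s ?v i)"
    using endo_gens(1,5) by (simp add: x_eigenvector_def x_op_def endo_simps T sum.distrib sum_subtractf
        scale_sum_right scale_left_diff_distrib algebra_simps del: funpow.simps)
      (simp add: algebra_simps)
  also have "(\<Sum>i\<le>d. eigen_coeff i *s ?v (Suc i)) = (\<Sum>i<d. eigen_coeff i *s ?v (Suc i))"
    using top by (simp add: lessThan_Suc_atMost[symmetric])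
  also have "(\<Sum>i\<le>d. ((theta 0 - theta i) * eigen_coeff i) *s ?v i) =
      (\<Sum>i<d. ((theta 0 - theta (Suc i)) * eigen_coeff (Suc i)) *s ?v (Suc i))"
    by (subst sum.atMost_shift) simp
  finally show ?thesis
    by (simp only: eigen_coeff_Suc diff_self right_minus_eq)
qed

lemma y_coeigenvector: "y_coeigenvector (y_op v) = q powi int d *s y_coeigenvector v"
proof -
  let ?v = "\<lambda>i. (L ^^ i) (proj i v)"
  have "y_coeigenvector (y_op v) =
      (\<Sum>i\<le>d. coeigen_coeff i *s ?v (Suc i)) +
      (\<Sum>i\<le>d. (coeigen_coeff i * q powi (int d - 2 * int i)) *s ?v i)"
    unfolding y_coeigenvector_def
    by (simp add: proj_y endo_simps[OF endo_funpow[OF endo_gens(2)]] scale_right_distrib sum.distrib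
        funpow_swap1)
  also have "(\<Sum>i\<le>d. coeigen_coeff i *s ?v (Suc i)) = (\<Sum>i<d. coeigen_coeff i *s ?v (Suc i))"
    using proj_above[of "Suc d" v] endo_zero[OF endo_funpow[OF endo_gens(2)], of "Suc d"]
    by (simp add: lessThan_Suc_atMost[symmetric])
  also have "\<dots> = (\<Sum>i\<le>d. ((q powi int d - q powi (int d - 2 * int i)) * coeigen_coeff i) *s ?v i)"
    by (subst sum.atMost_shift) (simp del: power_int_of_nat of_nat_Suc funpow.simps add: coeigen_coeff_Suc)
  finally show ?thesis
    by (simp add: y_coeigenvector_def scale_sum_right flip: sum.distrib scale_left_distrib)
      (simp add: algebra_simps)
qed

text \<open>
  The product of the factors \<open>x - theta j\<close> with \<open>j \<ge> 1\<close> kills everything without a lowest component, so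
  it sends \<open>w\<close> to a nonzero multiple of the eigenvector with the same lowest component.
\<close>

lemma x_stable_eigenvector:
  assumes W: "subspace W" "x_op ` W \<subseteq> W" "w \<in> W"
  shows "x_eigenvector (proj 0 w) \<in> W"
proof -
  define u where "u = proj 0 w"
  define cs where "cs = rev (map theta [1..<Suc d])"
  have u: "u \<in> wt (- int d)"
    using proj_in_wt[of 0 w] by (simp add: u_def)
  have "proj 0 (x_eigenvector u) = u"
  proof -
    have "proj 0 (x_eigenvector u) = (\<Sum>i\<le>d. eigen_coeff i *s proj 0 ((R ^^ i) u))"
      by (simp add: x_eigenvector_def endo_simps[OF endo_proj])
    also have "\<dots> = (\<Sum>i\<le>d. if i = 0 then u else 0)"
      by (rule sum.cong) (use proj_wt[OF R_pow_wt[OF u], of 0] in \<open>auto simp: eigen_coeff_def\<close>)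
    finally show ?thesis by simp
  qed
  then have "w - x_eigenvector u \<in> up 1"
    by (simp add: up_def endo_diff[OF endo_proj] u_def)
  then have "shift_prod x_op cs (w - x_eigenvector u) = 0"
    unfolding cs_def by (intro up_top shift_prod_x_up) auto
  then have "shift_prod x_op cs w = shift_prod x_op cs (x_eigenvector u)"
    by (simp add: endo_diff[OF endo_shift_prod[OF endo_x]])
  also have "\<dots> = prod_list (map (\<lambda>e. theta 0 - e) cs) *s x_eigenvector u"
    by (rule shift_prod_eigenvector[OF endo_x x_eigenvector[OF u]])
  finally have "prod_list (map (\<lambda>e. theta 0 - e) cs) *s x_eigenvector u \<in> W"
    using shift_prod_stable[OF W] by metis
  moreover have "prod_list (map (\<lambda>e. theta 0 - e) cs) \<noteq> 0"
  proof (rule prod_list_map_nonzero)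
    fix e assume "e \<in> set cs"
    then obtain j where "e = theta j" "j \<noteq> 0" by (auto simp: cs_def)
    then show "theta 0 - e \<noteq> 0"
      by (metis right_minus_eq theta_eq_iff)
  qed
  ultimately show ?thesis
    using subspace_scale[OF W(1), of _ "inverse (prod_list (map (\<lambda>e. theta 0 - e) cs))"]
    unfolding u_def by fastforce
qed

text \<open>
  The product of the factors of \<open>y\<close> for all eigenvalues except \<open>q\<^sup>d\<close> has its image in the lowest weight
  space. Its value there is found by applying the projection, which intertwines \<open>y\<close> with the scalar
  \<open>q\<^sup>d\<close>.
\<close>

lemma y_stable_coeigenvector:
  assumes W: "subspace W" "y_op ` W \<subseteq> W" "w \<in> W"
  shows "y_coeigenvector w \<in> W"
proof -
  interpret sw: weight_module scale q d L R Lm Rm T' T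
    by (rule swap)
  have y: "y_op = sw.x_op"
    by (simp add: fun_eq_iff y_op_def sw.x_op_def)
  define cs where "cs = rev (map theta [0..<d])"
  define v where "v = shift_prod y_op cs w"
  have "v \<in> sw.up d"
    unfolding v_def cs_def y by (rule sw.shift_prod_x_up) auto
  then have "v = sw.proj d v"
    using sw.sum_proj[of v] by (simp add: sw.up_def lessThan_Suc_atMost[symmetric])
  then have v: "v \<in> wt (- int d)"
    using sw.proj_in_wt[of d v] by (simp add: T'_weight_space)
  have endo_coeigen: "endo y_coeigenvector"
    unfolding y_coeigenvector_def endo_iff
    by (simp add: endo_simps[OF endo_proj] endo_simps[OF endo_funpow[OF endo_gens(2)]]
        scale_right_distrib sum.distrib scale_sum_right mult.commute)
  have "y_coeigenvector v = (\<Sum>i\<le>d. if i = 0 then v else 0)"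
    unfolding y_coeigenvector_def
    by (rule sum.cong) (use proj_wt[OF v] endo_zero[OF endo_funpow[OF endo_gens(2)]] in \<open>auto simp: coeigen_coeff_def\<close>)
  then have "v = y_coeigenvector v" by simp
  also have "\<dots> = prod_list (map (\<lambda>e. q powi int d - e) cs) *s y_coeigenvector w"
    unfolding v_def
    by (rule shift_prod_intertwine[where f = y_op and g = y_coeigenvector and c = "q powi int d",
          OF endo_y endo_coeigen y_coeigenvector])
  finally have "prod_list (map (\<lambda>e. q powi int d - e) cs) *s y_coeigenvector w \<in> W"
    using shift_prod_stable[OF W, of cs] v_def by simp
  moreover have "prod_list (map (\<lambda>e. q powi int d - e) cs) \<noteq> 0"
  proof (rule prod_list_map_nonzero)
    fix e assume "e \<in> set cs"
    then obtain j where j: "e = theta j" "j < d" by (auto simp: cs_def)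
    have "q powi int d \<noteq> theta j"
      unfolding q_powi_eq_iff using j(2) by simp
    then show "q powi int d - e \<noteq> 0"
      unfolding j(1) by (simp only: right_minus_eq not_False_eq_True)
  qed
  ultimately show ?thesis
    using subspace_scale[OF W(1), of _ "inverse (prod_list (map (\<lambda>e. q powi int d - e) cs))"]
    by fastforce
qed

lemma coeigen_eigen:
  assumes u: "u \<in> wt (- int d)" and sigma: "\<And>i. (L ^^ i) ((R ^^ i) u) = \<sigma> i *s u"
  shows "y_coeigenvector (x_eigenvector u) = (\<Sum>i\<le>d. coeigen_coeff i * eigen_coeff i * \<sigma> i) *s u"
proof -
  have "proj i (x_eigenvector u) = eigen_coeff i *s (R ^^ i) u" if i: "i \<le> d" for i
  proof -
    have "proj i (x_eigenvector u) = (\<Sum>k\<le>d. eigen_coeff k *s proj i ((R ^^ k) u))"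
      by (simp add: x_eigenvector_def endo_simps[OF endo_proj])
    also have "\<dots> = (\<Sum>k\<le>d. if k = i then eigen_coeff i *s (R ^^ i) u else 0)"
      by (rule sum.cong) (use proj_wt[OF R_pow_wt[OF u] i] in auto)
    finally show ?thesis using i by simp
  qed
  then show ?thesis
    by (simp add: y_coeigenvector_def endo_scale[OF endo_funpow[OF endo_gens(2)]] sigma scale_sum_left mult.assoc)
qed

text \<open>
  The factors with index \<open>j\<close> are inverse to \<open>(1 - q\<^sup>2\<^sup>j) (1 - q\<^sup>-\<^sup>2\<^sup>j) = - (q\<^sup>j - q\<^sup>-\<^sup>j)\<^sup>2\<close>. These are the
  coefficients of the Drinfel'd polynomial at \<open>q\<^sup>-\<^sup>1 (q - q\<^sup>-\<^sup>1)\<^sup>-\<^sup>2\<close>.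
\<close>

lemma coeff_product:
  "coeigen_coeff i * eigen_coeff i = (- 1) ^ i / ((q_fact q i)\<^sup>2 * (q - inverse q) ^ (2 * i))"
proof -
  have factor: "inverse (q powi int d - q powi (int d - 2 * int j)) * inverse (theta 0 - theta j) =
      - 1 / ((q_int q j)\<^sup>2 * (q - inverse q) ^ 2)" for j
  proof -
    define a x where "a = q ^ d" and "x = q ^ j"
    have nz: "a \<noteq> 0" "x \<noteq> 0" using q_nonzero by (simp_all add: a_def x_def)
    have sq: "q powi (2 * int j) = x * x"
      unfolding mult_2 x_def using q_nonzero by (subst power_int_add) auto
    have pow: "q powi int d = a" "q powi (int d - 2 * int j) = a / (x * x)" "theta 0 = 1 / a" "theta j = x * x / a"
      using q_nonzero sq power_int_diff[of q "int d" "2 * int j"] power_int_diff[of q "2 * int j" "int d"]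
      by (simp_all add: a_def power_int_minus inverse_eq_divide)
    have "(a - a / (x * x)) * (1 / a - x * x / a) = - ((x - inverse x)\<^sup>2)"
      using nz by (simp add: field_simps power2_eq_square)
    moreover have "(q_int q j)\<^sup>2 * (q - inverse q) ^ 2 = (x - inverse x)\<^sup>2"
      using q_minus_inverse by (simp add: q_int_def x_def power_divide power_inverse)
    ultimately show ?thesis
      unfolding pow by (simp add: divide_inverse flip: inverse_mult_distrib)
  qed
  have "coeigen_coeff i * eigen_coeff i = (\<Prod>j=1..i. - 1 / ((q_int q j)\<^sup>2 * (q - inverse q) ^ 2))"
    unfolding coeigen_coeff_def eigen_coeff_def prod.distrib[symmetric] factor ..
  also have "\<dots> = (- 1) ^ i / ((q_fact q i)\<^sup>2 * (q - inverse q) ^ (2 * i))"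
    unfolding q_fact_def
    by (induction i) (simp_all add: divide_inverse power_mult_distrib power_mult power2_eq_square mult_ac)
  finally show ?thesis .
qed

theorem x_y_irreducible:
  assumes sigma: "\<And>i u. u \<in> wt (- int d) \<Longrightarrow> (L ^^ i) ((R ^^ i) u) = \<sigma> i *s u"
    and nonzero: "(\<Sum>i\<le>d. (- 1) ^ i * \<sigma> i / ((q_fact q i)\<^sup>2 * (q - inverse q) ^ (2 * i))) \<noteq> 0"
    and W: "subspace W" "x_op ` W \<subseteq> W" "y_op ` W \<subseteq> W"
  shows "W = {0} \<or> W = UNIV"
proof (cases "W = {0}")
  case False
  then obtain w where w: "w \<in> W" "proj 0 w \<noteq> 0"
    using stable_meets_bottom[OF W] by blast
  define c where "c = (\<Sum>i\<le>d. (- 1) ^ i * \<sigma> i / ((q_fact q i)\<^sup>2 * (q - inverse q) ^ (2 * i)))"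
  have u: "proj 0 w \<in> wt (- int d)"
    using proj_in_wt[of 0 w] by simp
  have "y_coeigenvector (x_eigenvector (proj 0 w)) \<in> W"
    using x_stable_eigenvector[OF W(1,2) w(1)] y_stable_coeigenvector[OF W(1,3)] by blast
  then have "c *s proj 0 w \<in> W"
    unfolding coeigen_eigen[OF u sigma[OF u]] coeff_product by (simp add: c_def)
  then have "inverse c *s c *s proj 0 w \<in> W"
    by (rule subspace_scale[OF W(1)])
  then have "proj 0 w \<in> W"
    using nonzero by (simp add: c_def)
  then show ?thesis
    using bottom_generates[OF W _ u w(2)] by blast
qed simp

end

section \<open>From the quantum affine algebra to the q-Serre algebra\<close>

context q_vector_space
begin

lemma free_rep_serre_relator:
  assumes rep: "free_rep scale \<phi>"
  shows "\<phi> (serre_relator q a b) v =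
    twist (\<phi> a) (q powi (- 2)) (twist (\<phi> a) 1 (twist (\<phi> a) (q powi 2) (\<phi> b))) v"
proof -
  note vs = vector_space_axioms
  have mult: "\<phi> (p * r) w = \<phi> p (\<phi> r w)" and add: "\<phi> (p + r) w = \<phi> p w + \<phi> r w"
    and scalar: "\<phi> (free_scalar c) w = c *s w" for p r w c
    using rep by (simp_all add: free_rep_def)
  show ?thesis
    unfolding serre_expand[OF free_rep_linear[OF vs rep]]
    by (simp add: serre_relator_def free_rep_minus[OF vs rep] mult add scalar
        power2_eq_square power3_eq_cube)
qed

end

text \<open>
  A vector of lowest weight is its own component of index 0. So the part of index 0 cannot be smaller
  than the lowest weight space.
\<close>

lemma (in weight_module) decomposition_bottom:
  assumes "\<forall>i\<le>d. \<forall>u\<in>U i. T u = q powi (2 * int i - int d) *s u"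
    and "\<exists>u. (\<forall>i\<le>d. u i \<in> U i) \<and> v = (\<Sum>i\<le>d. u i)"
    and "v \<in> wt (- int d)"
  shows "v \<in> U 0"
proof -
  obtain u where u: "\<forall>i\<le>d. u i \<in> U i" "v = (\<Sum>i\<le>d. u i)"
    using assms(2) by blast
  have component: "proj 0 (u i) = (if i = 0 then u 0 else 0)" if i: "i \<le> d" for i
  proof -
    have "T (u i) = q powi (2 * int i - int d) *s u i"
      using u(1) assms(1) i by blast
    then have "u i \<in> wt (2 * int i - int d)"
      unfolding weight_space_def by blast
    then show ?thesis
      using proj_weight[of "u i" i 0] i by (cases "i = 0") auto
  qed
  have "v = proj 0 v"
    using proj_wt[OF assms(3), of 0] by simp
  also have "\<dots> = (\<Sum>i\<le>d. if i = 0 then u 0 else 0)"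
    unfolding u(2) endo_sum[OF endo_proj]
    by (rule sum.cong) (simp_all add: component)
  finally show ?thesis using u(1) by simp
qed

lemma (in weight_module) T_eigenvalue:
  assumes "w \<noteq> 0" "T w = c *s w"
  shows "\<exists>j\<le>d. c = q powi (2 * int j - int d)"
proof -
  have "\<exists>j\<le>d. proj j w \<noteq> 0"
    using assms(1) sum_proj[of w] by (metis atMost_iff sum.neutral)
  then obtain j where j: "j \<le> d" "proj j w \<noteq> 0" by blast
  have "c *s proj j w = q powi (2 * int j - int d) *s proj j w"
    using proj_T[OF j(1), of w] assms(2) endo_scale[OF endo_proj] by metis
  then show ?thesis
    using j by auto
qed

lemma uq_relatorsI:
  "free_gen (K i) * free_gen (Kinv i) - 1 \<in> uq_relators q"
  "free_gen (Kinv i) * free_gen (K i) - 1 \<in> uq_relators q"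
  "free_gen (K i) * free_gen (E s i) * free_gen (Kinv i) - free_scalar (q powi (2 * sign_int s)) * free_gen (E s i)
    \<in> uq_relators q"
  "i \<noteq> j \<Longrightarrow> free_gen (K i) * free_gen (E s j) * free_gen (Kinv i)
    - free_scalar (q powi (- 2 * sign_int s)) * free_gen (E s j) \<in> uq_relators q"
  "free_gen (E Pos i) * free_gen (E Neg i) - free_gen (E Neg i) * free_gen (E Pos i)
    - free_scalar (1 / (q - inverse q)) * (free_gen (K i) - free_gen (Kinv i)) \<in> uq_relators q"
  "i \<noteq> j \<Longrightarrow> serre_relator q (free_gen (E s i)) (free_gen (E s j)) \<in> uq_relators q"
  unfolding uq_relators_def Let_def by blast+

text \<open>
  $K_1$ acts as the inverse of $K_0$ because the two scalars by which they act on the \<open>i\<close>-th part are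
  inverse to each other. Then $K_1^{-1}$ acts as $K_0$, so the generators act through six operators.
\<close>

lemma uq_weight_module:
  fixes q :: "'k::field" and scale :: "'k \<Rightarrow> 'v::ab_group_add \<Rightarrow> 'v"
    and act :: "(uq_gen fmon \<Rightarrow>\<^sub>0 'k) set \<Rightarrow> 'v \<Rightarrow> 'v"
  assumes q: "q \<noteq> 0" "\<And>n::nat. n > 0 \<Longrightarrow> q ^ n \<noteq> 1"
    and vs: "vector_space scale" and fin: "finite_dimensional scale"
    and str: "module_structure (uq_relators q) scale act"
    and irr: "irreducible_module (uq_relators q) scale act"
    and dec: "uq_decomposition q scale act 1 1 d U"
  defines "a \<equiv> gen_action (uq_relators q) act"
  shows "weight_module scale q d (a (E Pos N0)) (a (E Pos N1)) (a (E Neg N0)) (a (E Neg N1)) (a (K N0)) (a (Kinv N0))"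
    and "a (K N1) = a (Kinv N0)"
proof -
  interpret q_vector_space scale q
    using q vs by (simp add: q_vector_space_def q_vector_space_axioms_def)
  define \<phi> where "\<phi> p = act (presented_class (uq_relators q) p)" for p
  have rep: "free_rep scale \<phi>"
    unfolding \<phi>_def by (rule module_structure_free_rep[OF vs str])
  have \<phi>_gen: "\<phi> (free_gen g) = a g" for g
    by (simp add: \<phi>_def a_def gen_action_def)
  have rel: "\<phi> r v = 0" if "r \<in> uq_relators q" for r v
    unfolding \<phi>_def by (rule module_structure_relator[OF vs str that])
  have mult: "\<phi> (p * r) w = \<phi> p (\<phi> r w)" and scalar: "\<phi> (free_scalar c) w = scale c w" for p r w c
    using rep by (simp_all add: free_rep_def)
  note \<phi>_simps = free_rep_minus[OF vs rep] mult scalar free_rep_one[OF vs rep] \<phi>_gen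
  have lin: "endo (a g)" for g
    using free_rep_linear[OF vs rep, of "free_gen g"] by (simp add: \<phi>_gen)
  have inv: "a (K i) (a (Kinv i) v) = v" "a (Kinv i) (a (K i) v) = v" for i v
    using rel[OF uq_relatorsI(1), of i v] rel[OF uq_relatorsI(2), of i v] by (simp_all add: \<phi>_simps)
  have conj1: "a (K i) (a (E s i) v) = scale (q powi (2 * sign_int s)) (a (E s i) (a (K i) v))" for s i v
    using rel[OF uq_relatorsI(3), of i s "a (K i) v"] by (simp add: \<phi>_simps inv)
  have conj2: "a (K i) (a (E s j) v) = scale (q powi (- 2 * sign_int s)) (a (E s j) (a (K i) v))" if "i \<noteq> j" for s i j v
    using rel[OF uq_relatorsI(4)[OF that], of s "a (K i) v"] by (simp add: \<phi>_simps inv)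
  have comm: "a (E Pos i) (a (E Neg i) v) - a (E Neg i) (a (E Pos i) v)
      = scale (1 / (q - inverse q)) (a (K i) v - a (Kinv i) v)" for i v
    using rel[OF uq_relatorsI(5), of i v] by (simp add: \<phi>_simps)
  have serre: "serre (a (E s i)) (a (E s j))" if "i \<noteq> j" for s i j
    using rel[OF uq_relatorsI(6)[OF that], of s] unfolding serre_iff free_rep_serre_relator[OF rep] \<phi>_gen
    by blast
  have U: "subspace (U i)" "U i \<noteq> {0}" if "i \<le> d" for i
    using dec that by (simp_all add: uq_decomposition_def)
  have K0: "a (K N0) u = scale (q powi (2 * int i - int d)) u"
    and K1: "a (K N1) u = scale (q powi (int d - 2 * int i)) u" if "i \<le> d" "u \<in> U i" for i u
    using dec that by (simp_all add: uq_decomposition_def a_def)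
  have decomp: "\<exists>u. (\<forall>i\<le>d. u i \<in> U i) \<and> v = (\<Sum>i\<le>d. u i)" for v
    using dec unfolding uq_decomposition_def by blast
  show K1_eq: "a (K N1) = a (Kinv N0)"
  proof
    fix v
    obtain u where u: "\<forall>i\<le>d. u i \<in> U i" "v = (\<Sum>i\<le>d. u i)"
      using decomp by blast
    have "a (K N1) (u i) = a (Kinv N0) (u i)" if i: "i \<le> d" for i
    proof -
      have "a (Kinv N0) (a (K N0) (u i)) = u i"
        by (rule inv)
      then have *: "scale (q powi (2 * int i - int d)) (a (Kinv N0) (u i)) = u i"
        using K0[OF i, of "u i"] u(1) i by (simp add: endo_scale[OF lin])
      have "a (K N1) (u i) = scale (q powi (int d - 2 * int i)) (u i)"
        using K1[OF i] u(1) i by blast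
      also have "\<dots> = scale (q powi (int d - 2 * int i)) (scale (q powi (2 * int i - int d)) (a (Kinv N0) (u i)))"
        by (simp only: *)
      also have "\<dots> = a (Kinv N0) (u i)"
        using q(1) by (simp flip: power_int_add)
      finally show ?thesis .
    qed
    then show "a (K N1) v = a (Kinv N0) v"
      unfolding u(2) endo_sum[OF lin] by (intro sum.cong) auto
  qed
  have Kinv1_eq: "a (Kinv N1) v = a (K N0) v" for v
    using inv(2)[of N1 "a (K N0) v"] inv(2)[of N0 v] by (simp add: K1_eq)
  show "weight_module scale q d (a (E Pos N0)) (a (E Pos N1)) (a (E Neg N0)) (a (E Neg N1)) (a (K N0)) (a (Kinv N0))"
  proof (rule weight_module.intro[OF q_vector_space_axioms weight_module_axioms.intro])
    show "a (K N0) (a (E Pos N0) v) = scale (q powi 2) (a (E Pos N0) (a (K N0) v))" for v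
      using conj1[of N0 Pos v] by simp
    show "a (K N0) (a (E Pos N1) v) = scale (q powi (- 2)) (a (E Pos N1) (a (K N0) v))" for v
      using conj2[of N0 N1 Pos v] by simp
    show "a (K N0) (a (E Neg N0) v) = scale (q powi (- 2)) (a (E Neg N0) (a (K N0) v))" for v
      using conj1[of N0 Neg v] by simp
    show "a (K N0) (a (E Neg N1) v) = scale (q powi 2) (a (E Neg N1) (a (K N0) v))" for v
      using conj2[of N0 N1 Neg v] by simp
    show "a (E Pos N1) (a (E Neg N1) v) - a (E Neg N1) (a (E Pos N1) v)
        = scale (1 / (q - inverse q)) (a (Kinv N0) v - a (K N0) v)" for v
      using comm[of N1 v] by (simp add: K1_eq Kinv1_eq)
    show "\<exists>u. (\<forall>i\<le>d. u i \<in> weight_space (a (K N0)) (2 * int i - int d)) \<and> v = (\<Sum>i\<le>d. u i)" for v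
      using decomp[of v] K0 unfolding weight_space_def by blast
    show "weight_space (a (K N0)) (2 * int i - int d) \<noteq> {0}" if i: "i \<le> d" for i
    proof -
      obtain u where "u \<in> U i" "u \<noteq> 0"
        using U[OF i] subspace_0 by blast
      then show ?thesis
        using K0[OF i, of u] by (auto simp: weight_space_def)
    qed
    show "W = {0} \<or> W = UNIV"
      if W: "subspace W" "a (E Pos N0) ` W \<subseteq> W" "a (E Pos N1) ` W \<subseteq> W" "a (E Neg N0) ` W \<subseteq> W"
        "a (E Neg N1) ` W \<subseteq> W" "a (K N0) ` W \<subseteq> W" "a (Kinv N0) ` W \<subseteq> W" for W
    proof -
      have "a g ` W \<subseteq> W" for g
      proof (cases g)
        case (E s i)
        then show ?thesis using W by (cases s; cases i) auto
      next
        case (K i)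
        then show ?thesis using W K1_eq by (cases i) auto
      next
        case (Kinv i)
        then show ?thesis using W Kinv1_eq by (cases i) auto
      qed
      then have "submodule (uq_relators q) scale act W"
        unfolding a_def by (rule stable_imp_submodule[OF vs str W(1)])
      then show ?thesis
        using irr by (simp add: irreducible_module_def)
    qed
  qed (use lin inv comm serre fin in \<open>simp_all add: finite_dimensional_def\<close>)
qed

text \<open>
  This makes the lowest space independent of the decomposition. The sign is \<open>1\<close>, since
  \<open>- q\<^sup>m = q\<^sup>n\<close> would give \<open>m = n\<close> after squaring. Then the smallest exponents on both sides are compared.
\<close>

lemma (in weight_module) decomposition_sign_and_length:
  assumes two: "(2::'k) \<noteq> 0" and sign: "\<epsilon> \<in> {1, - 1}"
    and U: "\<forall>i\<le>d'. U i \<noteq> {0} \<and> subspace (U i)"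
    and T: "\<forall>i\<le>d'. \<forall>u\<in>U i. T u = (\<epsilon> * q powi (2 * int i - int d')) *s u"
    and sum: "\<And>v. \<exists>u. (\<forall>i\<le>d'. u i \<in> U i) \<and> v = (\<Sum>i\<le>d'. u i)"
  shows "\<epsilon> = 1 \<and> d' = d"
proof -
  have "\<exists>u. u \<in> U 0 \<and> u \<noteq> 0"
    using U subspace_0 by blast
  then obtain u where u: "u \<in> U 0" "u \<noteq> 0" by blast
  have "T u = (\<epsilon> * q powi (2 * int 0 - int d')) *s u"
    using T u(1) by blast
  then obtain j where j: "j \<le> d" "\<epsilon> * q powi (2 * int 0 - int d') = q powi (2 * int j - int d)"
    using T_eigenvalue[OF u(2)] by blast
  have eps: "\<epsilon> = 1"
  proof (rule ccontr)
    assume "\<epsilon> \<noteq> 1"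
    then have minus: "- (q powi (- int d')) = q powi (2 * int j - int d)"
      using sign j(2) by simp
    then have "q powi (- int d') * q powi (- int d') = q powi (2 * int j - int d) * q powi (2 * int j - int d)"
      by (metis minus_mult_minus)
    then have "q powi (- int d' + - int d') = q powi (2 * int j - int d + (2 * int j - int d))"
      using q_nonzero by (simp only: power_int_add simp_thms)
    then have "- int d' = 2 * int j - int d"
      unfolding q_powi_eq_iff by linarith
    then have "- (q powi (- int d')) = q powi (- int d')"
      using minus by simp
    then have "2 * q powi (- int d') = 0"
      by (metis add.right_inverse mult_2)
    then show False
      using two q_nonzero by simp
  qed
  have "int d' \<le> int d"
    using j eps by (simp add: q_powi_eq_iff del: power_int_minus)
  moreover have "\<not> d' < d"
  proof
    assume less: "d' < d"
    obtain v where v: "v \<in> wt (- int d)" "v \<noteq> 0"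
      using weight_nonzero[of 0] subspace_0[OF subspace_wt] by auto
    obtain w where w: "\<forall>i\<le>d'. w i \<in> U i" "v = (\<Sum>i\<le>d'. w i)"
      using sum by blast
    have "proj 0 (w i) = 0" if i: "i \<le> d'" for i
    proof -
      have "w i \<in> wt (2 * int i - int d')"
        using T w(1) i eps by (simp add: weight_space_def)
      then show ?thesis
        using proj_wt[of "w i" "2 * int i - int d'" 0] less by auto
    qed
    then have "proj 0 v = 0"
      unfolding w(2) endo_sum[OF endo_proj] by simp
    then show False
      using proj_wt[OF v(1), of 0] v(2) by simp
  qed
  ultimately show ?thesis
    using eps by simp
qed

theorem theorem1p7:
  fixes q :: "'k::{alg_closed_field, field_char_0}"
    and scale :: "'k \<Rightarrow> 'v::ab_group_add \<Rightarrow> 'v"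
    and act :: "(uq_gen fmon \<Rightarrow>\<^sub>0 'k) set \<Rightarrow> 'v \<Rightarrow> 'v"
  assumes "q \<noteq> 0"
    and "\<And>n::nat. n > 0 \<Longrightarrow> q ^ n \<noteq> 1"
    and "vector_space scale"
    and "finite_dimensional scale"
    and "module_structure (uq_relators q) scale act"
    and "irreducible_module (uq_relators q) scale act"
    and "uq_has_type q scale act (1, 1)"
    and "poly (drinfeld_poly q scale act) (inverse q * inverse ((q - inverse q)\<^sup>2)) \<noteq> 0"
  defines "e \<equiv> \<lambda>i. gen_action (uq_relators q) act (E Pos i)"
    and "k \<equiv> \<lambda>i. gen_action (uq_relators q) act (K i)"
  defines "extends \<equiv> \<lambda>act'.
      module_structure (aq_relators q) scale act' \<and>
      gen_action (aq_relators q) act' X = (\<lambda>v. e N0 v + k N0 v) \<and>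
      gen_action (aq_relators q) act' Y = (\<lambda>v. e N1 v + k N1 v)"
  shows "(\<exists>!act'. extends act') \<and>
    (\<forall>act'. extends act' \<longrightarrow>
       aq_nonnil q act' \<and>
       irreducible_module (aq_relators q) scale act' \<and>
       aq_has_type q scale act' (1, 1))"
proof -
  note vs = \<open>vector_space scale\<close>
  define a where "a = gen_action (uq_relators q) act"
  obtain d U where dec: "uq_decomposition q scale act 1 1 d U"
    using assms(7) by (auto simp: uq_has_type_def)
  interpret weight_module scale q d "a (E Pos N0)" "a (E Pos N1)" "a (E Neg N0)" "a (E Neg N1)"
    "a (K N0)" "a (Kinv N0)"
    unfolding a_def by (rule uq_weight_module[OF assms(1-6) dec])
  have K1: "a (K N1) = a (Kinv N0)"
    unfolding a_def by (rule uq_weight_module[OF assms(1-6) dec])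
  have x: "(\<lambda>v. e N0 v + k N0 v) = x_op" and y: "(\<lambda>v. e N1 v + k N1 v) = y_op"
    by (simp_all add: fun_eq_iff e_def k_def x_op_def y_op_def K1 flip: a_def)

  have bottom_eq: "U' 0 = wt (- int d)" if dec': "uq_decomposition q scale act \<epsilon>0 \<epsilon>1 d' U'" for \<epsilon>0 \<epsilon>1 d' U'
  proof -
    have sum: "\<exists>u. (\<forall>i\<le>d'. u i \<in> U' i) \<and> v = (\<Sum>i\<le>d'. u i)" for v
      using dec' unfolding uq_decomposition_def by blast
    have T: "\<forall>i\<le>d'. \<forall>u\<in>U' i. a (K N0) u = scale (\<epsilon>0 * q powi (2 * int i - int d')) u"
      using dec' unfolding uq_decomposition_def a_def by blast
    have "\<epsilon>0 = 1 \<and> d' = d"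
      by (rule decomposition_sign_and_length[OF _ _ _ T sum])
        (use dec' in \<open>simp_all add: uq_decomposition_def\<close>)
    then have T: "\<forall>i\<le>d. \<forall>u\<in>U' i. a (K N0) u = scale (q powi (2 * int i - int d)) u"
      and sum: "\<exists>u. (\<forall>i\<le>d. u i \<in> U' i) \<and> v = (\<Sum>i\<le>d. u i)" for v
      using T sum by auto
    show ?thesis
    proof
      show "wt (- int d) \<subseteq> U' 0"
        using decomposition_bottom[OF T sum] by blast
      show "U' 0 \<subseteq> wt (- int d)"
        using T[rule_format, of 0] unfolding weight_space_def by fastforce
    qed
  qed
  have bottom: "uq_bottom q scale act = wt (- int d)"
    unfolding uq_bottom_def
    by (rule the_equality) (use bottom_eq[OF dec] dec bottom_eq in blast)+

  obtain v0 where v0: "v0 \<in> wt (- int d)" "v0 \<noteq> 0"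
    using weight_nonzero[of 0] subspace_0[OF subspace_wt] by auto
  have "\<exists>c. \<forall>u\<in>wt (- int d). (a (E Pos N1) ^^ i) ((a (E Pos N0) ^^ i) u) = scale c u" for i
    by (rule bottom_scalar) (rule alg_closed_imp_poly_has_root)
  then obtain \<sigma> where \<sigma>: "\<And>i u. u \<in> wt (- int d) \<Longrightarrow>
      (a (E Pos N1) ^^ i) ((a (E Pos N0) ^^ i) u) = scale (\<sigma> i) u"
    by metis
  have drinfeld_sigma: "drinfeld_sigma q scale act i = \<sigma> i" for i
    unfolding drinfeld_sigma_def bottom
  proof (rule the_equality)
    show "eigenvalue_on scale ((gen_action (uq_relators q) act (E Pos N1) ^^ i) \<circ>
        (gen_action (uq_relators q) act (E Pos N0) ^^ i)) (wt (- int d)) (\<sigma> i)"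
      using v0 \<sigma> unfolding eigenvalue_on_def a_def by auto
    show "c = \<sigma> i" if c: "eigenvalue_on scale ((gen_action (uq_relators q) act (E Pos N1) ^^ i) \<circ>
        (gen_action (uq_relators q) act (E Pos N0) ^^ i)) (wt (- int d)) c" for c
    proof -
      obtain w where "w \<in> wt (- int d)" "w \<noteq> 0"
        "(a (E Pos N1) ^^ i) ((a (E Pos N0) ^^ i) w) = scale c w"
        using c unfolding eigenvalue_on_def a_def comp_def by blast
      then show ?thesis using \<sigma> by auto
    qed
  qed
  have \<sigma>_zero: "\<sigma> i = 0" if "d < i" for i
  proof -
    have "(a (E Pos N0) ^^ i) v0 = 0"
      by (rule wt_trivial_outside[OF R_pow_wt[OF v0(1)]]) (use that in auto)
    then show ?thesis
      using \<sigma>[OF v0(1), of i] endo_zero[OF endo_funpow[OF endo_gens(2)]] v0(2) by simp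
  qed
  define z where "z = inverse q * inverse ((q - inverse q)\<^sup>2)"
  have "poly (drinfeld_poly q scale act) z =
      (\<Sum>i | \<sigma> i \<noteq> 0. (- 1) ^ i * \<sigma> i * q ^ i / (q_fact q i)\<^sup>2 * z ^ i)"
    by (simp add: drinfeld_poly_def drinfeld_sigma poly_sum poly_monom)
  also have "\<dots> = (\<Sum>i\<le>d. (- 1) ^ i * \<sigma> i * q ^ i / (q_fact q i)\<^sup>2 * z ^ i)"
    by (rule sum.mono_neutral_left) (use \<sigma>_zero in \<open>auto intro: leI\<close>)
  also have "\<dots> = (\<Sum>i\<le>d. (- 1) ^ i * \<sigma> i / ((q_fact q i)\<^sup>2 * (q - inverse q) ^ (2 * i)))"
  proof (rule sum.cong)
    fix i
    have "q ^ i * z ^ i = inverse ((q - inverse q) ^ (2 * i))"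
    proof -
      have "q * z = inverse ((q - inverse q)\<^sup>2)"
        using q_nonzero by (simp add: z_def mult.assoc[symmetric])
      then show ?thesis
        by (simp add: power_mult power_inverse flip: power_mult_distrib)
    qed
    then show "(- 1) ^ i * \<sigma> i * q ^ i / (q_fact q i)\<^sup>2 * z ^ i =
        (- 1) ^ i * \<sigma> i / ((q_fact q i)\<^sup>2 * (q - inverse q) ^ (2 * i))"
      by (simp add: divide_inverse mult_ac)
  qed simp
  finally have nonzero: "(\<Sum>i\<le>d. (- 1) ^ i * \<sigma> i / ((q_fact q i)\<^sup>2 * (q - inverse q) ^ (2 * i))) \<noteq> 0"
    using assms(8) by (simp add: z_def)

  have extends_iff: "extends act' \<longleftrightarrow> module_structure (aq_relators q) scale act' \<and>
      gen_action (aq_relators q) act' X = x_op \<and> gen_action (aq_relators q) act' Y = y_op" for act'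
    by (simp add: extends_def x y)
  have "\<exists>act'. extends act'"
  proof -
    define f where "f g = (case g of X \<Rightarrow> x_op | Y \<Rightarrow> y_op)" for g
    have "endo (f g)" for g
      using endo_x endo_y by (cases g) (simp_all add: f_def)
    then obtain \<phi> where \<phi>: "free_rep scale \<phi>" "\<And>g. \<phi> (free_gen g) = f g"
      using free_rep_exists[OF vs] by metis
    have "\<phi> r v = 0" if "r \<in> aq_relators q" for r v
    proof -
      have "serre (f X) (f Y)" "serre (f Y) (f X)"
        using serre_x_y serre_y_x by (simp_all add: f_def)
      then show ?thesis
        using that free_rep_serre_relator[OF \<phi>(1)] unfolding serre_iff
        by (auto simp: aq_relators_def \<phi>(2))
    qed
    then obtain act' where "module_structure (aq_relators q) scale act'"
      "\<forall>g. gen_action (aq_relators q) act' g = f g"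
      using free_rep_factors[OF vs \<phi>(1)] \<phi>(2) by metis
    then show ?thesis
      by (auto simp: extends_iff f_def)
  qed
  moreover have "act1 = act2" if "extends act1" "extends act2" for act1 act2
  proof (rule module_structure_unique[OF vs])
    show "gen_action (aq_relators q) act1 g = gen_action (aq_relators q) act2 g" for g
      using that by (cases g) (simp_all add: extends_iff)
  qed (use that in \<open>simp_all add: extends_iff\<close>)
  moreover have "aq_nonnil q act' \<and> irreducible_module (aq_relators q) scale act' \<and> aq_has_type q scale act' (1, 1)"
    if "extends act'" for act'
  proof -
    have str: "module_structure (aq_relators q) scale act'"
      and gens: "gen_action (aq_relators q) act' X = x_op" "gen_action (aq_relators q) act' Y = y_op"
      using that by (simp_all add: extends_iff)
    have not_nilpotent: "\<not> nilpotent_map f"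
      if f: "endo f" "\<exists>w. w \<noteq> 0 \<and> f w = scale (theta 0) w" for f
    proof
      assume "nilpotent_map f"
      then obtain n where n: "\<And>v. (f ^^ n) v = 0"
        by (auto simp: nilpotent_map_def)
      obtain w where w: "w \<noteq> 0" "f w = scale (theta 0) w"
        using f(2) by blast
      have "(f ^^ m) w = scale (theta 0 ^ m) w" for m
        by (induction m) (use w(2) f(1) in \<open>simp_all add: endo_scale mult.commute\<close>)
      then show False
        using n[of w] w(1) q_nonzero by auto
    qed
    have "aq_nonnil q act'"
      unfolding aq_nonnil_def gens
      using not_nilpotent[OF endo_x] not_nilpotent[OF endo_y] x_eigenvalues y_eigenvalues by blast
    moreover have "irreducible_module (aq_relators q) scale act'"
      unfolding irreducible_module_def
    proof (intro conjI allI impI)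
      show "(UNIV :: 'v set) \<noteq> {0}"
        using v0(2) by blast
      fix W assume W: "submodule (aq_relators q) scale act' W"
      show "W = {0} \<or> W = UNIV"
      proof (rule x_y_irreducible[OF \<sigma> nonzero])
        show "subspace W"
          using W by (simp add: submodule_def)
        show "x_op ` W \<subseteq> W" "y_op ` W \<subseteq> W"
          using submodule_stable[OF vs W] gens by (metis image_subsetI)+
      qed
    qed
    moreover have "aq_has_type q scale act' (1, 1)"
    proof -
      have "{c. \<exists>i\<le>d. c = theta i} = {1 * q powi (int d - 2 * int i) | i. i \<le> d}"
      proof (intro equalityI subsetI)
        fix c assume "c \<in> {c. \<exists>i\<le>d. c = theta i}"
        then obtain i where i: "i \<le> d" "c = theta i" by blast
        then have "c = 1 * q powi (int d - 2 * int (d - i))"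
          by (simp add: of_nat_diff)
        then show "c \<in> {1 * q powi (int d - 2 * int i) | i. i \<le> d}"
          using diff_le_self by blast
      next
        fix c assume "c \<in> {1 * q powi (int d - 2 * int i) | i. i \<le> d}"
        then obtain i where i: "i \<le> d" "c = 1 * q powi (int d - 2 * int i)" by blast
        then have "c = theta (d - i)"
          by (simp add: of_nat_diff)
        then show "c \<in> {c. \<exists>i\<le>d. c = theta i}"
          using diff_le_self by blast
      qed
      then show ?thesis
        unfolding aq_has_type_def gens eigenvalue_on_def
        using x_eigenvalues y_eigenvalues by (intro case_prodI conjI exI[of _ d]) auto
    qed
    ultimately show ?thesis by blast
  qed
  ultimately show ?thesis by blast
qed

end
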